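(* Let $f:\mathbb{R}_{\ge 0}\times\mathbb{R}^{n_x}\times\mathbb{R}^{n_w}\to\mathbb{R}^{n_x}$ be $C^1$ and consider the system $\dot x=f(t,x,w)$. Let $\|\cdot\|$ be a norm on $\mathbb{R}^{n_x}$ that is either a differentiable norm, the $\ell_1$-norm, or the $\ell_\infty$-norm, and let $\mu$ be its induced logarithmic norm. Let $\mathbb{R}^{n_w}$ be equipped with a norm and write $\|\cdot\|_{w\to x}$ for the induced operator norm of $n_x\times n_w$ matrices. Let $\mathcal{W}\subset\mathbb{R}^{n_w}$ be compact and let $\mathring w\in\mathcal{W}$. Let $\mathring x_0\in\mathbb{R}^{n_x}$, $\alpha_0\in GL(n_x)$, $y_0>0$. Define the controlled embedding system $$\dot{\mathring x}(t)=f(t,\mathring x,\mathring w),$$ $$\dot\alpha(t)=U(t,\mathring x,\alpha,y),$$ $$\dot y(t)=\Big(\max_i\mu\big(U(t,\mathring x,\alpha,y)\,\alpha^{-1}+\alpha M^x_i(t)\alpha^{-1}\big)\Big)\,y+\max_j\|\alpha M^w_j(t)\|_{w\to x},$$ where $\{M^x_i(t)\}_i\subset\mathbb{R}^{n_x\times n_x}$ and $\{M^w_j(t)\}_j\subset\mathbb{R}^{n_x\times n_w}$ are finite sets of matrices such that, for every $(x,w)\in\partial\llbracket\mathring x,\alpha,y\rrbracket\times\mathcal{W}$, $$f(t,x,w)-f(t,\mathring x,\mathring w)\in\operatorname{co}\{M^x_i(t)\}_i\,(x-\mathring x)+\operatorname{co}\{M^w_j(t)\}_j\,(w-\mathring w).$$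 Then for every $t\ge 0$, $$\mathcal{R}_f\big(t;0,\llbracket\mathring x_0,\alpha_0,y_0\rrbracket,\mathcal{W}\big)\subseteq\llbracket\mathring x(t),\alpha(t),y(t)\rrbracket,$$ where $t\mapsto(\mathring x(t),\alpha(t),y(t))$ is the trajectory of the embedding system with $(\mathring x(0),\alpha(0),y(0))=(\mathring x_0,\alpha_0,y_0)$, under any locally Lipschitz map $U:(t,\mathring x,\alpha,y)\mapsto U(t,\mathring x,\alpha,y)\in\mathbb{R}^{n_x\times n_x}$.
   Context: Normotope: given a norm $\|\cdot\|$ on $\mathbb{R}^{n_x}$, a center $\mathring x\in\mathbb{R}^{n_x}$, a shape matrix $\alpha\in GL(n_x)$ (invertible $n_x\times n_x$ real matrices) and an offset $y>0$, the normotope is $\llbracket\mathring x,\alpha,y\rrbracket:=\{x\in\mathbb{R}^{n_x}:\|\alpha(x-\mathring x)\|\le y\}$; $\partial\llbracket\mathring x,\alpha,y\rrbracket$ denotes its boundary. Operator norm: for a linear map $A$ between normed spaces, the operator norm is $\sup_{\|x\|=1}\|Ax\|$; $\|\cdot\|_{x\to x}$ is the one induced on $n_x\times n_x$ matrices by $\|\cdot\|$, and $\|\cdot\|_{w\to x}$ the one for maps from $\mathbb{R}^{n_w}$ (with its norm) to $(\mathbb{R}^{n_x},\|\cdot\|)$. Induced logarithmic norm: for $A\in\mathbb{R}^{n_x\times n_x}$, $\mu(A)=\limsup_{h\searrow 0}\frac{\|I+hA\|_{x\to x}-1}{h}$. $\operatorname{co}\mathcal{S}$ denotes the convex hull of $\mathcal{S}$.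 For sets of matrices $\mathcal{M}^x,\mathcal{M}^w$ and vectors $v,u$, $\mathcal{M}^x v+\mathcal{M}^w u=\{M^xv+M^wu:M^x\in\mathcal{M}^x,\,M^w\in\mathcal{M}^w\}$. Reachable set: $\phi_f(t;t_0,x_0,\mathbf{w})$ denotes the unique solution of $\dot x=f(t,x,\mathbf{w}(t))$, $x(t_0)=x_0$, for an essentially bounded disturbance map $\mathbf{w}$. For $\mathcal{X}_0\subseteq\mathbb{R}^{n_x}$ and $\mathcal{W}\subset\mathbb{R}^{n_w}$ compact, $\mathcal{R}_f(t;t_0,\mathcal{X}_0,\mathcal{W}):=\{\phi_f(t;t_0,x_0,\mathbf{w}):x_0\in\mathcal{X}_0,\ \mathbf{w}:[t_0,t]\to\mathcal{W}\}$.
   Formalization: Added: W lies in the closed unit ball about ẘ, i.e. ‖w−ẘ‖≤1 for all w∈W. Without it the claim is false: f=w, W=[−10,10], ẘ=0, U=0, M^x={0}, M^w={1}, α₀=y₀=1 gives y=1+t, yet 1+10t is reached. *)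

theory Defs
  imports "HOL-Analysis.Analysis"
begin

text \<open>Norms are passed as functions, because the type-class norm of \<^typ>\<open>real^'n\<close> is always the
  Euclidean one.\<close>

definition is_norm :: "('a::real_vector \<Rightarrow> real) \<Rightarrow> bool" where
  "is_norm N \<longleftrightarrow> (\<forall>x. 0 \<le> N x) \<and> (\<forall>x. N x = 0 \<longleftrightarrow> x = 0) \<and>
     (\<forall>c x. N (c *\<^sub>R x) = \<bar>c\<bar> * N x) \<and> (\<forall>x y. N (x + y) \<le> N x + N y)"

text \<open>No norm is differentiable at the origin, so the origin is excluded.\<close>

definition differentiable_norm :: "('a::real_normed_vector \<Rightarrow> real) \<Rightarrow> bool" where
  "differentiable_norm N \<longleftrightarrow> is_norm N \<and> (\<forall>x. x \<noteq> 0 \<longrightarrow> N differentiable (at x))"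

definition l1_norm :: "real^'n \<Rightarrow> real" where
  "l1_norm x = (\<Sum>i\<in>UNIV. \<bar>x $ i\<bar>)"

definition op_norm ::
    "(real^'m \<Rightarrow> real) \<Rightarrow> (real^'n \<Rightarrow> real) \<Rightarrow> real^'m^'n \<Rightarrow> real" where
  "op_norm N1 N2 A = (SUP x\<in>{x. N1 x = 1}. N2 (A *v x))"

text \<open>The difference quotient is bounded in absolute value by the operator norm of \<open>A\<close>, so the
  limes superior, taken in \<^typ>\<open>ereal\<close>, is finite.\<close>

definition log_norm :: "(real^'n \<Rightarrow> real) \<Rightarrow> real^'n^'n \<Rightarrow> real" where
  "log_norm N A = real_of_ereal
     (Limsup (at_right 0) (\<lambda>h. ereal ((op_norm N N (mat 1 + h *\<^sub>R A) - 1) / h)))"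

definition normotope ::
    "(real^'n \<Rightarrow> real) \<Rightarrow> real^'n \<Rightarrow> real^'n^'n \<Rightarrow> real \<Rightarrow> (real^'n) set" where
  "normotope N c \<alpha> y = {x. N (\<alpha> *v (x - c)) \<le> y}"

text \<open>Derivatives are taken within \<open>S\<close>, hence are one-sided where \<open>S\<close> contains boundary points.\<close>

definition C1_on :: "'a::real_normed_vector set \<Rightarrow> ('a \<Rightarrow> 'b::real_normed_vector) \<Rightarrow> bool" where
  "C1_on S g \<longleftrightarrow> (\<exists>g' :: 'a \<Rightarrow> 'a \<Rightarrow>\<^sub>L 'b.
     (\<forall>z\<in>S. (g has_derivative blinfun_apply (g' z)) (at z within S)) \<and> continuous_on S g')"

definition locally_lipschitz_on ::
    "'a::metric_space set \<Rightarrow> ('a \<Rightarrow> 'b::metric_space) \<Rightarrow> bool" where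
  "locally_lipschitz_on S g \<longleftrightarrow> (\<forall>p\<in>S. \<exists>r>0. \<exists>L. L-lipschitz_on (ball p r \<inter> S) g)"

text \<open>Solutions forward in time of \<open>x' = g(t, x)\<close> in integral form. This comprises both
  the absolutely continuous solutions in the sense of Caratheodory and the everywhere
  differentiable ones.\<close>

definition ode_solution ::
    "(real \<Rightarrow> 'a::euclidean_space \<Rightarrow> 'a) \<Rightarrow> real \<Rightarrow> real set \<Rightarrow> (real \<Rightarrow> 'a) \<Rightarrow> bool" where
  "ode_solution g t0 J x \<longleftrightarrow>
     (\<forall>t\<in>J. ((\<lambda>s. g s (x s)) has_integral (x t - x t0)) {t0..t})"

text \<open>Disturbances are Lebesgue measurable; for compact \<open>W\<close>, essential boundedness is automatic.
  Only solutions that exist on all of \<open>{t0..t}\<close> contribute a point.\<close>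

definition reachable_set ::
    "(real \<times> (real^'n) \<times> (real^'m) \<Rightarrow> real^'n) \<Rightarrow> real \<Rightarrow> real \<Rightarrow> (real^'n) set \<Rightarrow>
     (real^'m) set \<Rightarrow> (real^'n) set" where
  "reachable_set f t t0 X0 W =
     {x t |x w. x t0 \<in> X0 \<and> w \<in> borel_measurable (lebesgue_on {t0..t}) \<and>
        (\<forall>s\<in>{t0..t}. w s \<in> W) \<and> ode_solution (\<lambda>s \<xi>. f (s, \<xi>, w s)) t0 {t0..t} x}"

definition embedding_domain :: "(real \<times> (real^'n) \<times> (real^'n^'n) \<times> real) set" where
  "embedding_domain = {(t, c, \<alpha>, y). 0 \<le> t \<and> invertible \<alpha> \<and> 0 < y}"

definition embedding_field ::
    "(real^'n \<Rightarrow> real) \<Rightarrow> (real^'m \<Rightarrow> real) \<Rightarrow>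
     (real \<times> (real^'n) \<times> (real^'m) \<Rightarrow> real^'n) \<Rightarrow>
     (real \<times> (real^'n) \<times> (real^'n^'n) \<times> real \<Rightarrow> real^'n^'n) \<Rightarrow>
     (real \<Rightarrow> (real^'n^'n) set) \<Rightarrow> (real \<Rightarrow> (real^'m^'n) set) \<Rightarrow> real^'m \<Rightarrow>
     real \<Rightarrow> (real^'n) \<times> (real^'n^'n) \<times> real \<Rightarrow> (real^'n) \<times> (real^'n^'n) \<times> real" where
  "embedding_field N Nw f U Mx Mw wc t = (\<lambda>(c, \<alpha>, y).
     (f (t, c, wc),
      U (t, c, \<alpha>, y),
      Max ((\<lambda>M. log_norm N (U (t, c, \<alpha>, y) ** matrix_inv \<alpha> + \<alpha> ** M ** matrix_inv \<alpha>)) ` Mx t) * y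
        + Max ((\<lambda>M. op_norm Nw N (\<alpha> ** M)) ` Mw t)))"

end

theory Submission
  imports Defs
begin

hide_const (open) Polynomial.content

text \<open>Let \<open>x\<close> be a disturbed trajectory, and put \<open>e = \<alpha> (x - xc)\<close> and \<open>g = N e - y\<close>, so that \<open>x\<close> lies in
  the normotope exactly where \<open>g \<le> 0\<close>. The claim follows from a differential inequality
  \<open>g' \<le> L g\<close>, valid at all times with \<open>g \<ge> 0\<close>: a function that starts with \<open>g \<le> 0\<close> and obeys it cannot become positive.

  For the inequality, move \<open>x\<close> radially to the point \<open>xb = xc + (y / N e) (x - xc)\<close> of the boundary, the
  only place where the matrix sets say anything about \<open>f\<close>. There the increment of \<open>f\<close>
  is \<open>A (xb - xc) + B (w - wc)\<close> with \<open>A\<close> and \<open>B\<close> in the convex hulls, hence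
  \<open>e' = (U \<alpha>\<inverse> + \<alpha> A \<alpha>\<inverse>) ((y / N e) e) + \<alpha> B (w - wc) + r\<close>, where \<open>r\<close> collects
  the errors of replacing \<open>x\<close> by \<open>xb\<close>. In the direction of the first term \<open>N\<close> grows at a rate of at most the
  logarithmic norm times \<open>(y / N e) N e = y\<close>; the radial scaling thus costs nothing here, however
  large the matrices are. The second term contributes at most an operator norm, and \<open>r\<close> is
  of size \<open>L g\<close>, because \<open>f\<close> is locally Lipschitz in the state and \<open>xb\<close> differs from \<open>x\<close> by a multiple
  of \<open>g\<close>. Convexity in \<open>A\<close> and \<open>B\<close> passes from the hulls to the finitely many generators, and
  the first two bounds add up to \<open>y'\<close> (\<open>embedding_directional_bound\<close>).

  Trajectories are given as indefinite integrals in the sense of Henstock and Kurzweil, and the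
  right-hand side for \<open>y\<close> may be unbounded and not even absolutely integrable. Hence no derivative is ever taken
  along a trajectory. Henstock's lemma says that the increments of an indefinite integral agree,
  up to a small total error, with those of the formal derivative at the tags of a fine
  division. This yields a product rule for \<open>e = \<alpha> (x - xc)\<close> (\<open>primitive_on_bilinear\<close>) and an estimate of \<open>N e\<close>
  by the integral of a bound on its directional derivatives (\<open>integral_comparison_convex\<close>); the
  differential inequality for \<open>g\<close> becomes an integral one, to which \<open>nonpos_of_integral_gronwall\<close> applies.\<close>

section \<open>Indefinite Henstock-Kurzweil integrals\<close>

text \<open>The increments over all subintervals, not only those from the left end point, are recorded
  because comparison is applied on short intervals in the interior.\<close>

definition primitive_on :: "real \<Rightarrow> real \<Rightarrow> (real \<Rightarrow> 'a::euclidean_space) \<Rightarrow> (real \<Rightarrow> 'a) \<Rightarrow> bool" where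
  "primitive_on a b F X \<longleftrightarrow>
     (\<forall>s t. a \<le> s \<longrightarrow> s \<le> t \<longrightarrow> t \<le> b \<longrightarrow> (F has_integral (X t - X s)) {s..t})"

lemma primitive_onD:
  "primitive_on a b F X \<Longrightarrow> a \<le> s \<Longrightarrow> s \<le> t \<Longrightarrow> t \<le> b \<Longrightarrow> (F has_integral (X t - X s)) {s..t}"
  unfolding primitive_on_def by blast

lemma primitive_on_subinterval:
  "primitive_on a b F X \<Longrightarrow> a \<le> a' \<Longrightarrow> b' \<le> b \<Longrightarrow> primitive_on a' b' F X"
  unfolding primitive_on_def by auto

lemma primitive_onI:
  fixes X :: "real \<Rightarrow> 'a::euclidean_space"
  assumes "\<And>t. a \<le> t \<Longrightarrow> t \<le> b \<Longrightarrow> (F has_integral (X t - X a)) {a..t}"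
  shows "primitive_on a b F X"
  unfolding primitive_on_def
proof (intro allI impI)
  fix s t assume st: "a \<le> s" "s \<le> t" "t \<le> b"
  have 1: "(F has_integral (X s - X a)) {a..s}" and 2: "(F has_integral (X t - X a)) {a..t}"
    using assms st by auto
  have "F integrable_on {s..t}"
    using integrable_subinterval_real[of F a t s t] 2 st by auto
  then obtain I where I: "(F has_integral I) {s..t}" by blast
  have "(F has_integral (X s - X a) + I) {a..t}"
    using has_integral_combine[OF st(1,2) 1 I] .
  then have "X s - X a + I = X t - X a" using 2 has_integral_unique by blast
  then have "I = X t - X s" by (simp add: algebra_simps)
  then show "(F has_integral (X t - X s)) {s..t}" using I by simp
qed

lemma ode_solution_imp_primitive_on:
  assumes "ode_solution g 0 J x" "is_interval J" "0 \<in> J" "t \<in> J"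
  shows "primitive_on 0 t (\<lambda>s. g s (x s)) x"
proof (rule primitive_onI)
  fix s assume "0 \<le> s" "s \<le> t"
  then have "s \<in> J" using assms mem_is_interval_1_I by metis
  then show "((\<lambda>s. g s (x s)) has_integral x s - x 0) {0..s}"
    using assms(1) unfolding ode_solution_def by blast
qed

lemma primitive_on_bounded_linear:
  assumes "primitive_on a b F X" "bounded_linear h"
  shows "primitive_on a b (\<lambda>s. h (F s)) (\<lambda>s. h (X s))"
  unfolding primitive_on_def
proof (intro allI impI)
  fix s t assume "a \<le> s" "s \<le> t" "t \<le> b"
  from has_integral_linear[OF primitive_onD[OF assms(1) this] assms(2)]
  show "((\<lambda>s. h (F s)) has_integral h (X t) - h (X s)) {s..t}"
    by (simp add: o_def linear_diff[OF bounded_linear.linear[OF assms(2)]])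
qed

lemma primitive_on_diff:
  assumes "primitive_on a b F X" "primitive_on a b G Y"
  shows "primitive_on a b (\<lambda>s. F s - G s) (\<lambda>s. X s - Y s)"
  unfolding primitive_on_def
proof (intro allI impI)
  fix s t assume "a \<le> s" "s \<le> t" "t \<le> b"
  from has_integral_diff[OF primitive_onD[OF assms(1) this] primitive_onD[OF assms(2) this]]
  show "((\<lambda>s. F s - G s) has_integral X t - Y t - (X s - Y s)) {s..t}"
    by (simp add: algebra_simps)
qed

lemma primitive_on_continuous:
  assumes "primitive_on a b F X"
  shows "continuous_on {a..b} X"
proof (cases "a \<le> b")
  case True
  have "continuous_on {a..b} (\<lambda>t. integral {a..t} F + X a)"
    using primitive_onD[OF assms _ True]
    by (intro continuous_intros indefinite_integral_continuous_1) auto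
  moreover have "integral {a..t} F + X a = X t" if "t \<in> {a..b}" for t
    using integral_unique[OF primitive_onD[OF assms, of a t]] that by auto
  ultimately show ?thesis by (rule continuous_on_eq)
qed auto

lemma continuous_on_interval_bounded:
  fixes X :: "real \<Rightarrow> 'a::real_normed_vector"
  assumes "continuous_on {a..b} X"
  obtains B where "0 < B" "\<And>s. s \<in> {a..b} \<Longrightarrow> norm (X s) \<le> B"
  using compact_imp_bounded[OF compact_continuous_image[OF assms compact_Icc]]
  unfolding bounded_pos by auto

section \<open>Henstock's lemma, the product rule and comparison along convex functions\<close>

lemma tagged_division_real_cell:
  fixes a b :: real
  assumes "p tagged_division_of {a..b}" "(\<tau>, K) \<in> p"
  obtains u v where "K = {u..v}" "Inf K = u" "Sup K = v" "content K = v - u"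
    "a \<le> u" "u \<le> \<tau>" "\<tau> \<le> v" "v \<le> b"
proof -
  obtain u v where K: "K = cbox u v"
    using tagged_division_ofD(4)[OF assms] by blast
  have "\<tau> \<in> K" "K \<subseteq> {a..b}" using tagged_division_ofD(2,3)[OF assms] by auto
  then show ?thesis using that[of u v] K by auto
qed

text \<open>Henstock's lemma for the cells of a division: it bounds the sum of the norms of the local
  errors, not just the norm of their sum. It takes the place of differentiability almost everywhere.\<close>

lemma primitive_on_Henstock:
  fixes X :: "real \<Rightarrow> 'a::euclidean_space"
  assumes X: "primitive_on a b F X" and ab: "a \<le> b" and "0 < \<epsilon>"
  obtains \<gamma> where "gauge \<gamma>"
    "\<And>p. p tagged_division_of {a..b} \<Longrightarrow> \<gamma> fine p \<Longrightarrow>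
       (\<Sum>(\<tau>, K)\<in>p. norm (X (Sup K) - X (Inf K) - content K *\<^sub>R F \<tau>)) < \<epsilon>"
proof -
  have "F integrable_on cbox a b" using primitive_onD[OF X order.refl ab] by auto
  from Henstock_lemma[OF this \<open>0 < \<epsilon>\<close>] obtain \<gamma> where \<gamma>: "gauge \<gamma>"
    "\<And>p. p tagged_partial_division_of cbox a b \<Longrightarrow> \<gamma> fine p \<Longrightarrow>
       (\<Sum>(x,K)\<in>p. norm (content K *\<^sub>R F x - integral K F)) < \<epsilon>" by blast
  show thesis
  proof (rule that[OF \<gamma>(1)])
    fix p assume p: "p tagged_division_of {a..b}" "\<gamma> fine p"
    have "integral K F = X (Sup K) - X (Inf K)" if "(\<tau>, K) \<in> p" for \<tau> K
    proof -
      from tagged_division_real_cell[OF p(1) that] obtain u v where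
        "K = {u..v}" "Inf K = u" "Sup K = v" "a \<le> u" "u \<le> \<tau>" "\<tau> \<le> v" "v \<le> b" by metis
      then show ?thesis using integral_unique[OF primitive_onD[OF X, of u v]] by simp
    qed
    then have "(\<Sum>(\<tau>, K)\<in>p. norm (X (Sup K) - X (Inf K) - content K *\<^sub>R F \<tau>))
        = (\<Sum>(x,K)\<in>p. norm (content K *\<^sub>R F x - integral K F))"
      by (intro sum.cong refl) (auto simp: norm_minus_commute)
    also have "\<dots> < \<epsilon>" using \<gamma>(2)[of p] p by (auto simp: tagged_division_of_def)
    finally show "(\<Sum>(\<tau>, K)\<in>p. norm (X (Sup K) - X (Inf K) - content K *\<^sub>R F \<tau>)) < \<epsilon>" .
  qed
qed

lemma gauge_from_radius:
  fixes P :: "'a::euclidean_space \<Rightarrow> 'a \<Rightarrow> bool"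
  assumes "\<And>x. x \<in> S \<Longrightarrow> \<exists>r>0. \<forall>y\<in>S. dist y x < r \<longrightarrow> P x y"
  obtains \<gamma> where "gauge \<gamma>" "\<And>x y. x \<in> S \<Longrightarrow> y \<in> S \<Longrightarrow> y \<in> \<gamma> x \<Longrightarrow> P x y"
proof -
  obtain r where r: "\<And>x. x \<in> S \<Longrightarrow> 0 < r x \<and> (\<forall>y\<in>S. dist y x < r x \<longrightarrow> P x y)"
    using assms by metis
  show thesis
  proof (rule that)
    show "gauge (\<lambda>x. ball x (if x \<in> S then r x else 1))"
      by (rule gauge_ball_dependent) (use r in auto)
  qed (use r in \<open>auto simp: dist_commute\<close>)
qed

lemma sum_content_tagged_division_real:
  fixes a b :: real
  assumes "p tagged_division_of {a..b}" "a \<le> b"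
  shows "(\<Sum>(\<tau>, K)\<in>p. content K) = b - a"
  using additive_content_tagged_division[of p a b] assms by simp

text \<open>On a cell from \<open>u\<close> to \<open>v\<close> with tag \<open>\<tau>\<close>, the product increment is
  \<open>X v (Y v - Y u) + (X v - X u) Y u\<close>. Replacing the increments by \<open>G \<tau>\<close> and \<open>F \<tau>\<close> costs a bounded
  factor times the errors of Henstock's lemma. Moving \<open>X v\<close> and \<open>Y u\<close> to the tag costs little, since the
  gauge may depend on the size of \<open>F \<tau>\<close> and \<open>G \<tau>\<close> and both factors are continuous.
  This reaches unbounded \<open>F\<close> and \<open>G\<close>.\<close>

lemma primitive_on_bilinear:
  fixes X :: "real \<Rightarrow> 'a::euclidean_space" and Y :: "real \<Rightarrow> 'b::euclidean_space"
    and prod :: "'a \<Rightarrow> 'b \<Rightarrow> 'c::euclidean_space"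
  assumes bil: "bounded_bilinear prod"
    and X: "primitive_on a b F X" and Y: "primitive_on a b G Y"
  shows "primitive_on a b (\<lambda>s. prod (F s) (Y s) + prod (X s) (G s)) (\<lambda>s. prod (X s) (Y s))"
proof (rule primitive_onI)
  fix t assume at: "a \<le> t" "t \<le> b"
  interpret bounded_bilinear prod by fact
  let ?H = "\<lambda>s. prod (F s) (Y s) + prod (X s) (G s)" and ?Z = "\<lambda>s. prod (X s) (Y s)"
  have X': "primitive_on a t F X" and Y': "primitive_on a t G Y"
    using X Y at by (auto intro: primitive_on_subinterval)
  have cX: "continuous_on {a..t} X" and cY: "continuous_on {a..t} Y"
    using X' Y' primitive_on_continuous by auto
  obtain C where C: "C > 0" "\<And>x y. norm (prod x y) \<le> norm x * norm y * C"
    using pos_bounded by blast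
  obtain BX where BX0: "0 < BX" and BX: "\<And>s. s \<in> {a..t} \<Longrightarrow> norm (X s) \<le> BX"
    using continuous_on_interval_bounded[OF cX] by blast
  obtain BY where BY0: "0 < BY" and BY: "\<And>s. s \<in> {a..t} \<Longrightarrow> norm (Y s) \<le> BY"
    using continuous_on_interval_bounded[OF cY] by blast
  show "(?H has_integral ?Z t - ?Z a) {a..t}"
  proof (cases "a = t")
    case True
    then show ?thesis using has_integral_refl(2)[of ?H a] by simp
  next
    case False
    with at have lt: "a < t" by simp
    show ?thesis
      unfolding has_integral_factor_content_real
    proof (intro allI impI)
      fix e :: real assume "0 < e"
      show "\<exists>d. gauge d \<and> (\<forall>p. p tagged_division_of {a..t} \<and> d fine p \<longrightarrow>
          norm ((\<Sum>(x,k)\<in>p. content k *\<^sub>R ?H x) - (?Z t - ?Z a)) \<le> e * content {a..t})"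
      proof -
        define D where "D = C * (BX + BY + 2)"
        have D: "D > 0" using C BX0 BY0 by (simp add: D_def)
        define \<epsilon> where "\<epsilon> = e * (t - a) / (2 * D)"
        have \<epsilon>: "\<epsilon> > 0" using \<open>0 < e\<close> lt D by (simp add: \<epsilon>_def)
        obtain \<gamma>1 where \<gamma>1: "gauge \<gamma>1" "\<And>p. p tagged_division_of {a..t} \<Longrightarrow> \<gamma>1 fine p \<Longrightarrow>
         (\<Sum>(\<tau>, K)\<in>p. norm (X (Sup K) - X (Inf K) - content K *\<^sub>R F \<tau>)) < \<epsilon>"
          using primitive_on_Henstock[OF X' at(1) \<epsilon>] by blast
        obtain \<gamma>2 where \<gamma>2: "gauge \<gamma>2" "\<And>p. p tagged_division_of {a..t} \<Longrightarrow> \<gamma>2 fine p \<Longrightarrow>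
         (\<Sum>(\<tau>, K)\<in>p. norm (Y (Sup K) - Y (Inf K) - content K *\<^sub>R G \<tau>)) < \<epsilon>"
          using primitive_on_Henstock[OF Y' at(1) \<epsilon>] by blast
        define \<eta> where "\<eta> = e / (2 * C)"
        have \<eta>: "\<eta> > 0" using \<open>0 < e\<close> C by (simp add: \<eta>_def)
        let ?P = "\<lambda>\<tau> s. norm (X s - X \<tau>) * norm (G \<tau>) \<le> \<eta> / 2 \<and> norm (Y s - Y \<tau>) * norm (F \<tau>) \<le> \<eta> / 2"
        have near: "\<exists>r>0. \<forall>s\<in>{a..t}. dist s \<tau> < r \<longrightarrow> ?P \<tau> s" if \<tau>: "\<tau> \<in> {a..t}" for \<tau>
        proof -
          have "\<forall>\<^sub>F s in at \<tau> within {a..t}. norm (X s - X \<tau>) * norm (G \<tau>) < \<eta> / 2"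
            using cX \<tau> \<eta> unfolding continuous_on_def
            by (intro order_tendstoD(2)[where y = "norm (X \<tau> - X \<tau>) * norm (G \<tau>)"] tendsto_intros) auto
          moreover have "\<forall>\<^sub>F s in at \<tau> within {a..t}. norm (Y s - Y \<tau>) * norm (F \<tau>) < \<eta> / 2"
            using cY \<tau> \<eta> unfolding continuous_on_def
            by (intro order_tendstoD(2)[where y = "norm (Y \<tau> - Y \<tau>) * norm (F \<tau>)"] tendsto_intros) auto
          ultimately have "\<forall>\<^sub>F s in at \<tau> within {a..t}. ?P \<tau> s"
            by eventually_elim auto
          then obtain r where r: "r > 0" "\<And>s. s \<in> {a..t} \<Longrightarrow> s \<noteq> \<tau> \<Longrightarrow> dist s \<tau> < r \<Longrightarrow> ?P \<tau> s"
            unfolding eventually_at by auto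
          have "?P \<tau> \<tau>" using \<eta> by simp
          then show ?thesis using r by metis
        qed
        obtain \<gamma>3 where \<gamma>3: "gauge \<gamma>3"
          "\<And>x s. x \<in> {a..t} \<Longrightarrow> s \<in> {a..t} \<Longrightarrow> s \<in> \<gamma>3 x \<Longrightarrow> ?P x s"
          using gauge_from_radius[OF near] by blast
        let ?\<gamma> = "\<lambda>x. \<gamma>1 x \<inter> (\<gamma>2 x \<inter> \<gamma>3 x)"
        show ?thesis
        proof (intro exI[of _ ?\<gamma>] conjI allI impI)
          show "gauge ?\<gamma>" using \<gamma>1(1) \<gamma>2(1) \<gamma>3(1) by (intro gauge_Int)
          fix p assume "p tagged_division_of {a..t} \<and> ?\<gamma> fine p"
          then have p: "p tagged_division_of {a..t}" and f: "\<gamma>1 fine p" "\<gamma>2 fine p" "\<gamma>3 fine p"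
            by (auto simp: fine_Int)
          let ?rX = "\<lambda>\<tau> K. norm (X (Sup K) - X (Inf K) - content K *\<^sub>R F \<tau>)"
          let ?rY = "\<lambda>\<tau> K. norm (Y (Sup K) - Y (Inf K) - content K *\<^sub>R G \<tau>)"
          have cell: "norm (?Z (Sup K) - ?Z (Inf K) - content K *\<^sub>R ?H \<tau>)
              \<le> C * BY * ?rX \<tau> K + C * BX * ?rY \<tau> K + C * \<eta> * content K"
            if K: "(\<tau>, K) \<in> p" for \<tau> K
          proof -
            from tagged_division_real_cell[OF p K] obtain u v where
              uv: "K = {u..v}" "Inf K = u" "Sup K = v" "content K = v - u"
                "a \<le> u" "u \<le> \<tau>" "\<tau> \<le> v" "v \<le> t" by metis
            have "K \<subseteq> \<gamma>3 \<tau>" using f(3) K by (auto simp: fine_def)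
            then have "u \<in> \<gamma>3 \<tau>" "v \<in> \<gamma>3 \<tau>" using uv by auto
            then have "?P \<tau> u" "?P \<tau> v" using \<gamma>3(2)[of \<tau> u] \<gamma>3(2)[of \<tau> v] uv by simp_all
            then have P: "norm (Y u - Y \<tau>) * norm (F \<tau>) \<le> \<eta> / 2" "norm (X v - X \<tau>) * norm (G \<tau>) \<le> \<eta> / 2"
              by auto
            let ?h = "v - u"
            have h: "0 \<le> ?h" using uv by simp
            \<comment> \<open>Two Henstock errors, and two shifts to the tag.\<close>
            have "?Z v - ?Z u - ?h *\<^sub>R ?H \<tau> =
              prod (X v) (Y v - Y u - ?h *\<^sub>R G \<tau>) + ?h *\<^sub>R prod (X v - X \<tau>) (G \<tau>) +
              prod (X v - X u - ?h *\<^sub>R F \<tau>) (Y u) + ?h *\<^sub>R prod (F \<tau>) (Y u - Y \<tau>)"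
              by (simp add: add_left add_right diff_left diff_right scaleR_left scaleR_right scaleR_add_right scaleR_diff_right)
            then have "norm (?Z v - ?Z u - ?h *\<^sub>R ?H \<tau>) \<le>
              norm (prod (X v) (Y v - Y u - ?h *\<^sub>R G \<tau>)) + ?h * norm (prod (X v - X \<tau>) (G \<tau>)) +
              norm (prod (X v - X u - ?h *\<^sub>R F \<tau>) (Y u)) + ?h * norm (prod (F \<tau>) (Y u - Y \<tau>))"
              using h by (simp only:) (intro norm_triangle_mono order.refl; simp)
            also have "\<dots> \<le> BX * norm (Y v - Y u - ?h *\<^sub>R G \<tau>) * C + ?h * (\<eta> / 2 * C) +
              norm (X v - X u - ?h *\<^sub>R F \<tau>) * BY * C + ?h * (\<eta> / 2 * C)"
            proof (intro add_mono mult_left_mono h)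
              show "norm (prod (X v) (Y v - Y u - ?h *\<^sub>R G \<tau>)) \<le> BX * norm (Y v - Y u - ?h *\<^sub>R G \<tau>) * C"
                using C BX[of v] uv by (intro order.trans[OF C(2)] mult_right_mono) auto
              show "norm (prod (X v - X u - ?h *\<^sub>R F \<tau>) (Y u)) \<le> norm (X v - X u - ?h *\<^sub>R F \<tau>) * BY * C"
                using C BY[of u] uv by (intro order.trans[OF C(2)] mult_right_mono mult_left_mono) auto
              show "norm (prod (X v - X \<tau>) (G \<tau>)) \<le> \<eta> / 2 * C"
                using C P by (intro order.trans[OF C(2)] mult_right_mono) auto
              show "norm (prod (F \<tau>) (Y u - Y \<tau>)) \<le> \<eta> / 2 * C"
                using C P by (intro order.trans[OF C(2)] mult_right_mono) (auto simp: mult.commute)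
            qed
            finally have "norm (?Z v - ?Z u - ?h *\<^sub>R ?H \<tau>) \<le> \<dots>" .
            moreover have "BX * p * C + ?h * (\<eta> / 2 * C) + q * BY * C + ?h * (\<eta> / 2 * C)
                = C * BY * q + C * BX * p + C * \<eta> * ?h" for p q
              by (simp add: field_simps)
            ultimately show ?thesis by (simp only: uv(2-4))
          qed
          have "(?Z t - ?Z a) - (\<Sum>(\<tau>, K)\<in>p. content K *\<^sub>R ?H \<tau>)
              = (\<Sum>(\<tau>, K)\<in>p. ?Z (Sup K) - ?Z (Inf K) - content K *\<^sub>R ?H \<tau>)"
            unfolding additive_tagged_division_1[OF at(1) p, of ?Z, symmetric] split_def
            by (rule sum_subtractf[symmetric])
          then have "norm ((\<Sum>(\<tau>, K)\<in>p. content K *\<^sub>R ?H \<tau>) - (?Z t - ?Z a))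
              = norm (\<Sum>(\<tau>, K)\<in>p. ?Z (Sup K) - ?Z (Inf K) - content K *\<^sub>R ?H \<tau>)"
            by (subst norm_minus_commute) (rule arg_cong[where f = norm])
          also have "\<dots> \<le> (\<Sum>(\<tau>, K)\<in>p. C * BY * ?rX \<tau> K + C * BX * ?rY \<tau> K + C * \<eta> * content K)"
            by (rule sum_norm_le) (clarify, rule cell)
          also have "\<dots> = C * BY * (\<Sum>(\<tau>, K)\<in>p. ?rX \<tau> K) + C * BX * (\<Sum>(\<tau>, K)\<in>p. ?rY \<tau> K)
               + C * \<eta> * (\<Sum>(\<tau>, K)\<in>p. content K)"
            by (simp add: split_def sum.distrib sum_distrib_left)
          also have "\<dots> \<le> C * BY * \<epsilon> + C * BX * \<epsilon> + C * \<eta> * (t - a)"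
            using \<gamma>1(2)[OF p f(1)] \<gamma>2(2)[OF p f(2)] sum_content_tagged_division_real[OF p at(1)] C BX0 BY0 \<eta>
            by (intro add_mono mult_left_mono) auto
          also have "\<dots> \<le> D * \<epsilon> + C * \<eta> * (t - a)"
            using C \<epsilon> by (simp add: D_def algebra_simps)
          also have "\<dots> = e * content {a..t}"
            using C D at by (simp add: \<epsilon>_def \<eta>_def field_simps)
          finally show "norm ((\<Sum>(x,K)\<in>p. content K *\<^sub>R ?H x) - (?Z t - ?Z a)) \<le> e * content {a..t}" .
        qed
      qed
    qed
  qed
qed

text \<open>If the directional derivative of \<open>N\<close> at \<open>e \<tau>\<close> towards \<open>E \<tau>\<close> is at most \<open>k \<tau>\<close>, then \<open>N e\<close>
  grows by at most the integral of \<open>k\<close>. A cell with tag \<open>\<tau>\<close> starts at some \<open>u\<close> other than \<open>\<tau>\<close>,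
  so the derivative bound is needed near \<open>e \<tau>\<close> as well. Convexity provides it: difference quotients
  increase with the step, hence it is enough to control the quotient for one fixed step \<open>h\<close>, and that one is
  continuous in the base point. For the same reason the hypothesis asks for a single step only.\<close>

lemma integral_comparison_convex:
  fixes e :: "real \<Rightarrow> 'a::euclidean_space" and N :: "'a \<Rightarrow> real"
  assumes e: "primitive_on a b E e" and ab: "a \<le> b"
    and conv: "convex_on UNIV N" and lip: "C-lipschitz_on UNIV N"
    and k: "(k has_integral I) {a..b}"
    and dir: "\<And>\<tau> \<epsilon>. a \<le> \<tau> \<Longrightarrow> \<tau> \<le> b \<Longrightarrow> 0 < \<epsilon> \<Longrightarrow>
       \<exists>h>0. N (e \<tau> + h *\<^sub>R E \<tau>) \<le> N (e \<tau>) + h * (k \<tau> + \<epsilon>)"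
  shows "N (e b) - N (e a) \<le> I"
proof (rule field_le_epsilon)
  fix \<delta> :: real assume "0 < \<delta>"
  have C: "0 \<le> C" using lipschitz_on_nonneg[OF lip] .
  define \<epsilon> where "\<epsilon> = \<delta> / (1 + (b - a) + C)"
  have den: "0 < 1 + (b - a) + C" using C ab by simp
  have \<epsilon>: "0 < \<epsilon>" using \<open>0 < \<delta>\<close> den by (simp add: \<epsilon>_def)
  have ce: "continuous_on {a..b} e" using primitive_on_continuous[OF e] .
  have cN: "continuous_on UNIV N" using lipschitz_on_continuous_on[OF lip] .
  have near: "\<exists>r>0. \<forall>s\<in>{a..b}. dist s \<tau> < r \<longrightarrow> (\<forall>h\<ge>0. h \<le> r \<longrightarrow>
      N (e s + h *\<^sub>R E \<tau>) \<le> N (e s) + h * (k \<tau> + \<epsilon>))" if \<tau>: "\<tau> \<in> {a..b}" for \<tau>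
  proof -
    obtain h0 where h0: "h0 > 0" "N (e \<tau> + h0 *\<^sub>R E \<tau>) \<le> N (e \<tau>) + h0 * (k \<tau> + \<epsilon> / 2)"
      using dir[of \<tau> "\<epsilon> / 2"] \<tau> \<epsilon> by auto
    define q where "q s = N (e s + h0 *\<^sub>R E \<tau>) - N (e s)" for s
    have q\<tau>: "q \<tau> < h0 * (k \<tau> + \<epsilon>)"
      using h0 \<epsilon> by (auto simp: q_def algebra_simps intro: order.strict_trans1)
    have "continuous_on {a..b} q"
      unfolding q_def by (intro continuous_intros continuous_on_compose2[OF cN] ce) auto
    then have "(q \<longlongrightarrow> q \<tau>) (at \<tau> within {a..b})"
      using \<tau> by (simp add: continuous_on_def)
    then have "\<forall>\<^sub>F s in at \<tau> within {a..b}. q s < h0 * (k \<tau> + \<epsilon>)"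
      using q\<tau> by (rule order_tendstoD(2))
    then obtain r where r: "r > 0"
      "\<And>s. s \<in> {a..b} \<Longrightarrow> s \<noteq> \<tau> \<Longrightarrow> dist s \<tau> < r \<Longrightarrow> q s < h0 * (k \<tau> + \<epsilon>)"
      unfolding eventually_at by auto
    show ?thesis
    proof (intro exI[of _ "min r h0"] conjI ballI impI allI)
      fix s h assume s: "s \<in> {a..b}" "dist s \<tau> < min r h0" and h: "0 \<le> h" "h \<le> min r h0"
      have qs: "q s \<le> h0 * (k \<tau> + \<epsilon>)" using r(2)[of s] q\<tau> s by (cases "s = \<tau>") auto
      let ?\<theta> = "h / h0"
      have \<theta>: "0 \<le> ?\<theta>" "?\<theta> \<le> 1" using h h0 by auto
      \<comment> \<open>A step \<open>h \<le> h0\<close> is a convex combination of no step and the full step \<open>h0\<close>.\<close>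
      have "e s + h *\<^sub>R E \<tau> = (1 - ?\<theta>) *\<^sub>R e s + ?\<theta> *\<^sub>R (e s + h0 *\<^sub>R E \<tau>)"
        using h0(1) by (simp add: algebra_simps)
      then have "N (e s + h *\<^sub>R E \<tau>) \<le> (1 - ?\<theta>) * N (e s) + ?\<theta> * N (e s + h0 *\<^sub>R E \<tau>)"
        using convex_onD[OF conv \<theta>, of "e s" "e s + h0 *\<^sub>R E \<tau>"] by simp
      also have "\<dots> = N (e s) + ?\<theta> * q s" by (simp add: q_def algebra_simps)
      also have "\<dots> \<le> N (e s) + ?\<theta> * (h0 * (k \<tau> + \<epsilon>))"
        using mult_left_mono[OF qs \<theta>(1)] by simp
      also have "\<dots> = N (e s) + h * (k \<tau> + \<epsilon>)" using h0(1) by simp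
      finally show "N (e s + h *\<^sub>R E \<tau>) \<le> N (e s) + h * (k \<tau> + \<epsilon>)" .
    qed (use r(1) h0(1) in auto)
  qed
  then obtain r where r: "\<And>\<tau>. \<tau> \<in> {a..b} \<Longrightarrow> 0 < r \<tau> \<and> (\<forall>s\<in>{a..b}. dist s \<tau> < r \<tau> \<longrightarrow>
      (\<forall>h\<ge>0. h \<le> r \<tau> \<longrightarrow> N (e s + h *\<^sub>R E \<tau>) \<le> N (e s) + h * (k \<tau> + \<epsilon>)))"
    by metis
  \<comment> \<open>Half the radius, so that the whole length of a cell is an admissible step.\<close>
  define \<gamma>3 where "\<gamma>3 \<tau> = ball \<tau> (if \<tau> \<in> {a..b} then r \<tau> / 2 else 1)" for \<tau>
  have \<gamma>3: "gauge \<gamma>3" unfolding \<gamma>3_def by (rule gauge_ball_dependent) (use r in auto)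
  obtain \<gamma>1 where \<gamma>1: "gauge \<gamma>1" "\<And>p. p tagged_division_of {a..b} \<Longrightarrow> \<gamma>1 fine p \<Longrightarrow>
       (\<Sum>(\<tau>, K)\<in>p. norm (e (Sup K) - e (Inf K) - content K *\<^sub>R E \<tau>)) < \<epsilon>"
    using primitive_on_Henstock[OF e ab \<epsilon>] by blast
  obtain \<gamma>2 where \<gamma>2: "gauge \<gamma>2" "\<And>p. p tagged_division_of {a..b} \<Longrightarrow> \<gamma>2 fine p \<Longrightarrow>
       norm ((\<Sum>(x,K)\<in>p. content K *\<^sub>R k x) - I) < \<epsilon>"
    using k[unfolded has_integral_real] \<epsilon> by metis
  obtain p where p: "p tagged_division_of {a..b}"
    and f: "(\<lambda>x. \<gamma>1 x \<inter> (\<gamma>2 x \<inter> \<gamma>3 x)) fine p"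
    by (rule fine_division_exists_real[OF gauge_Int[OF \<gamma>1(1) gauge_Int[OF \<gamma>2(1) \<gamma>3]]])
  then have f1: "\<gamma>1 fine p" and f2: "\<gamma>2 fine p" and f3: "\<gamma>3 fine p" by (auto simp: fine_Int)
  let ?r = "\<lambda>\<tau> K. norm (e (Sup K) - e (Inf K) - content K *\<^sub>R E \<tau>)"
  have cell: "N (e (Sup K)) - N (e (Inf K)) \<le> content K * k \<tau> + content K * \<epsilon> + C * ?r \<tau> K"
    if K: "(\<tau>, K) \<in> p" for \<tau> K
  proof -
    from tagged_division_real_cell[OF p K] obtain u v where
      uv: "K = {u..v}" "Inf K = u" "Sup K = v" "content K = v - u"
        "a \<le> u" "u \<le> \<tau>" "\<tau> \<le> v" "v \<le> b" by metis
    have "K \<subseteq> \<gamma>3 \<tau>" using f3 K by (auto simp: fine_def)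
    then have "u \<in> \<gamma>3 \<tau>" "v \<in> \<gamma>3 \<tau>" using uv by auto
    then have d: "dist u \<tau> < r \<tau> / 2" "dist v \<tau> < r \<tau> / 2"
      using uv by (auto simp: \<gamma>3_def dist_commute)
    then have "dist u \<tau> < r \<tau>" "v - u \<le> r \<tau>" using uv by (auto simp: dist_real_def)
    then have 1: "N (e u + (v - u) *\<^sub>R E \<tau>) \<le> N (e u) + (v - u) * (k \<tau> + \<epsilon>)"
      using r[of \<tau>] uv by auto
    have "dist (N (e v)) (N (e u + (v - u) *\<^sub>R E \<tau>)) \<le> C * dist (e v) (e u + (v - u) *\<^sub>R E \<tau>)"
      using lipschitz_onD[OF lip] by auto
    then have "N (e v) - N (e u + (v - u) *\<^sub>R E \<tau>) \<le> C * ?r \<tau> K"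
      by (simp add: uv(2-4) dist_norm diff_diff_eq)
    with 1 show ?thesis by (simp add: uv(2-4) algebra_simps)
  qed
  have "N (e b) - N (e a) = (\<Sum>(\<tau>, K)\<in>p. N (e (Sup K)) - N (e (Inf K)))"
    using additive_tagged_division_1[OF ab p, of "\<lambda>t. N (e t)"] by simp
  also have "\<dots> \<le> (\<Sum>(\<tau>, K)\<in>p. content K * k \<tau> + content K * \<epsilon> + C * ?r \<tau> K)"
    by (rule sum_mono) (clarify, rule cell)
  also have "\<dots> = (\<Sum>(\<tau>, K)\<in>p. content K *\<^sub>R k \<tau>) + (\<Sum>(\<tau>, K)\<in>p. content K) * \<epsilon>
      + C * (\<Sum>(\<tau>, K)\<in>p. ?r \<tau> K)"
    by (simp add: split_def sum.distrib sum_distrib_left sum_distrib_right)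
  also have "\<dots> \<le> (I + \<epsilon>) + (b - a) * \<epsilon> + C * \<epsilon>"
    using \<gamma>1(2)[OF p f1] \<gamma>2(2)[OF p f2] sum_content_tagged_division_real[OF p ab] C
    by (intro add_mono mult_left_mono) auto
  also have "\<dots> = I + (1 + (b - a) + C) * \<epsilon>" by (simp add: algebra_simps)
  also have "\<dots> = I + \<delta>" using den by (simp add: \<epsilon>_def)
  finally show "N (e b) - N (e a) \<le> I + \<delta>" .
qed

section \<open>Norms on Euclidean spaces\<close>

lemma is_normD:
  assumes "is_norm N"
  shows is_norm_nonneg: "0 \<le> N x"
    and is_norm_eq_0: "N x = 0 \<longleftrightarrow> x = 0"
    and is_norm_scaleR: "N (c *\<^sub>R x) = \<bar>c\<bar> * N x"
    and is_norm_triangle: "N (x + y) \<le> N x + N y"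
  using assms unfolding is_norm_def by blast+

lemma is_norm_l1: "is_norm (l1_norm :: real^'n \<Rightarrow> real)"
  unfolding is_norm_def
proof (intro conjI allI)
  fix x y :: "real^'n" and c :: real
  show "0 \<le> l1_norm x" by (simp add: l1_norm_def sum_nonneg)
  show "l1_norm x = 0 \<longleftrightarrow> x = 0"
    by (simp add: l1_norm_def sum_nonneg_eq_0_iff vec_eq_iff)
  show "l1_norm (c *\<^sub>R x) = \<bar>c\<bar> * l1_norm x"
    by (simp add: l1_norm_def abs_mult sum_distrib_left)
  show "l1_norm (x + y) \<le> l1_norm x + l1_norm y"
    unfolding l1_norm_def sum.distrib[symmetric] by (rule sum_mono) simp
qed

lemma is_norm_infnorm: "is_norm (infnorm :: 'a::euclidean_space \<Rightarrow> real)"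
  unfolding is_norm_def
  by (auto simp: infnorm_pos_le infnorm_eq_0 infnorm_mul intro: infnorm_triangle)

lemma is_norm_sum_le:
  assumes "is_norm N"
  shows "N (\<Sum>i\<in>I. g i) \<le> (\<Sum>i\<in>I. N (g i))"
proof (induction I rule: infinite_finite_induct)
  case (insert i I)
  then show ?case using is_norm_triangle[OF assms, of "g i" "\<Sum>i\<in>I. g i"] by simp
qed (use is_norm_eq_0[OF assms, of 0] in simp_all)

lemma is_norm_le_norm:
  fixes N :: "'a::euclidean_space \<Rightarrow> real"
  assumes N: "is_norm N"
  obtains C where "0 < C" "\<And>x. N x \<le> C * norm x"
proof
  let ?C = "(\<Sum>b\<in>Basis. N b) + 1"
  have S: "0 \<le> (\<Sum>b\<in>Basis. N b)" by (intro sum_nonneg is_norm_nonneg[OF N])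
  then show "0 < ?C" by simp
  fix x
  have "N x = N (\<Sum>b\<in>Basis. (x \<bullet> b) *\<^sub>R b)" by (simp add: euclidean_representation)
  also have "\<dots> \<le> (\<Sum>b\<in>Basis. \<bar>x \<bullet> b\<bar> * N b)"
    using is_norm_sum_le[OF N] by (simp flip: is_norm_scaleR[OF N])
  also have "\<dots> \<le> (\<Sum>b\<in>Basis. norm x * N b)"
    by (intro sum_mono mult_right_mono Basis_le_norm is_norm_nonneg[OF N])
  also have "\<dots> = norm x * (\<Sum>b\<in>Basis. N b)" by (rule sum_distrib_left[symmetric])
  also have "\<dots> \<le> ?C * norm x" by (simp add: algebra_simps)
  finally show "N x \<le> ?C * norm x" .
qed

lemma is_norm_lipschitz:
  fixes N :: "'a::euclidean_space \<Rightarrow> real"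
  assumes N: "is_norm N"
  obtains C where "C-lipschitz_on UNIV N"
proof -
  obtain C where C: "0 < C" "\<And>x. N x \<le> C * norm x" using is_norm_le_norm[OF N] by blast
  have *: "N x - N y \<le> C * norm (x - y)" for x y
    using is_norm_triangle[OF N, of "x - y" y] C(2)[of "x - y"] by simp
  have "dist (N x) (N y) \<le> C * dist x y" for x y
    using *[of x y] *[of y x]
    unfolding dist_norm real_norm_def norm_minus_commute[of y x] by linarith
  then have "C-lipschitz_on UNIV N" using C by (auto intro: lipschitz_onI)
  then show thesis using that by blast
qed

lemma is_norm_convex_on:
  assumes N: "is_norm N"
  shows "convex_on UNIV N"
proof (rule convex_onI)
  fix t :: real and x y assume "0 < t" "t < 1"
  then show "N ((1 - t) *\<^sub>R x + t *\<^sub>R y) \<le> (1 - t) * N x + t * N y"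
    using is_norm_triangle[OF N, of "(1 - t) *\<^sub>R x" "t *\<^sub>R y"] by (simp add: is_norm_scaleR[OF N])
qed simp

text \<open>The form of convexity used on the hulls of the matrix sets, with \<open>M\<close> the matrix.\<close>

lemma is_norm_affine_convex_on:
  assumes N: "is_norm N" and L: "linear L"
  shows "convex_on UNIV (\<lambda>M. N (p + L M))"
proof (rule convex_onI)
  fix t :: real and x y assume t: "0 < t" "t < 1"
  have "p + L ((1 - t) *\<^sub>R x + t *\<^sub>R y) = (1 - t) *\<^sub>R (p + L x) + t *\<^sub>R (p + L y)"
    by (simp only: linear_add[OF L] linear_scale[OF L]) (simp add: algebra_simps)
  then show "N (p + L ((1 - t) *\<^sub>R x + t *\<^sub>R y)) \<le> (1 - t) * N (p + L x) + t * N (p + L y)"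
    using is_norm_triangle[OF N, of "(1 - t) *\<^sub>R (p + L x)" "t *\<^sub>R (p + L y)"] t
    by (simp add: is_norm_scaleR[OF N])
qed simp

lemma norm_le_is_norm:
  fixes N :: "'a::euclidean_space \<Rightarrow> real"
  assumes N: "is_norm N"
  obtains c where "0 < c" "\<And>x. norm x \<le> c * N x"
proof -
  obtain C where "C-lipschitz_on UNIV N" using is_norm_lipschitz[OF N] .
  then have cN: "continuous_on UNIV N" by (rule lipschitz_on_continuous_on)
  have "sphere (0::'a) 1 \<noteq> {}" by simp
  then obtain z where z: "norm z = 1" "\<And>x. norm x = 1 \<Longrightarrow> N z \<le> N x"
    using continuous_attains_inf[of "sphere (0::'a) 1" N] continuous_on_subset[OF cN]
    by (auto simp: dist_norm)
  have "z \<noteq> 0" using z(1) by auto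
  then have Nz: "0 < N z" using is_norm_nonneg[OF N, of z] is_norm_eq_0[OF N, of z] by linarith
  show thesis
  proof
    show "0 < 1 / N z" using Nz by simp
    fix x
    show "norm x \<le> 1 / N z * N x"
    proof (cases "x = 0")
      case False
      then have "N z \<le> N ((1 / norm x) *\<^sub>R x)" by (intro z(2)) simp
      also have "\<dots> = N x / norm x" by (simp add: is_norm_scaleR[OF N])
      finally show ?thesis using False Nz by (simp add: field_simps)
    qed (use is_norm_nonneg[OF N] Nz in simp)
  qed
qed

lemma is_norm_normalized:
  assumes N: "is_norm N" and "x \<noteq> 0"
  shows "N ((1 / N x) *\<^sub>R x) = 1"
  using assms(2) is_norm_nonneg[OF N, of x] is_norm_eq_0[OF N, of x]
  by (simp add: is_norm_scaleR[OF N])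

section \<open>Operator norms and logarithmic norms\<close>

lemma bounded_bilinear_matrix_vector_mult:
  "bounded_bilinear ((*v) :: real^'m^'n \<Rightarrow> real^'m \<Rightarrow> real^'n)"
  unfolding bilinear_conv_bounded_bilinear[symmetric] bilinear_def
  by (intro conjI allI linearI)
    (simp_all only: matrix_vector_mult_add_rdistrib matrix_vector_right_distrib
        scaleR_matrix_vector_assoc[symmetric] matrix_vector_mult_scaleR)

text \<open>The supremum that defines the operator norm is a conditional one, so it carries information only
  once its set is known to be bounded; this is the equivalence of norms in finite dimension.\<close>

lemma op_norm_bdd:
  fixes A :: "real^'m^'n"
  assumes N1: "is_norm N1" and N2: "is_norm N2"
  shows "bdd_above ((\<lambda>x. N2 (A *v x)) ` {x. N1 x = 1})"
proof -
  obtain C where C: "0 < C" "\<And>x. N2 x \<le> C * norm x" using is_norm_le_norm[OF N2] by blast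
  obtain c where c: "0 < c" "\<And>x. norm x \<le> c * N1 x" using norm_le_is_norm[OF N1] by blast
  obtain K where K: "K > 0" "\<And>x. norm (A *v x) \<le> norm x * K"
    using bounded_linear.pos_bounded[OF matrix_vector_mul_bounded_linear[of A]] by blast
  have "N2 (A *v x) \<le> C * (c * K)" if "N1 x = 1" for x
  proof -
    have "norm x \<le> c" using c(2)[of x] that by simp
    then have "norm (A *v x) \<le> c * K"
      using K(2)[of x] mult_right_mono[of "norm x" c K] K(1) by linarith
    then show ?thesis using C(2)[of "A *v x"] mult_left_mono[of "norm (A *v x)" "c * K" C] C(1)
      by linarith
  qed
  then show ?thesis by (auto intro!: bdd_aboveI)
qed

lemma is_norm_matrix_vector_le:
  fixes A :: "real^'m^'n"
  assumes N1: "is_norm N1" and N2: "is_norm N2"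
  shows "N2 (A *v x) \<le> op_norm N1 N2 A * N1 x"
proof (cases "x = 0")
  case True
  then show ?thesis using is_norm_eq_0[OF N1, of 0] is_norm_eq_0[OF N2, of 0] by simp
next
  case False
  then have pos: "0 < N1 x" using is_norm_nonneg[OF N1, of x] is_norm_eq_0[OF N1, of x] by linarith
  have "N2 (A *v ((1 / N1 x) *\<^sub>R x)) \<le> op_norm N1 N2 A"
    unfolding op_norm_def
    by (rule cSUP_upper[OF _ op_norm_bdd[OF N1 N2]]) (simp add: is_norm_normalized[OF N1 False])
  then have "N2 (A *v x) / N1 x \<le> op_norm N1 N2 A"
    using pos by (simp add: matrix_vector_mult_scaleR is_norm_scaleR[OF N2])
  then show ?thesis using pos by (simp add: pos_divide_le_eq)
qed

lemma op_norm_le: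
  fixes A :: "real^'m^'n"
  assumes N1: "is_norm N1" and "\<And>x. N1 x = 1 \<Longrightarrow> N2 (A *v x) \<le> c"
  shows "op_norm N1 N2 A \<le> c"
  unfolding op_norm_def
proof (rule cSUP_least)
  have "axis undefined 1 \<noteq> (0 :: real^'m)" by (simp add: axis_eq_0_iff)
  from is_norm_normalized[OF N1 this] show "{x. N1 x = 1} \<noteq> {}" by blast
qed (use assms(2) in simp)

lemma op_norm_nonneg:
  fixes A :: "real^'m^'n"
  assumes N1: "is_norm N1" and N2: "is_norm N2"
  shows "0 \<le> op_norm N1 N2 A"
proof -
  let ?v = "axis undefined 1 :: real^'m"
  have v: "?v \<noteq> 0" by (simp add: axis_eq_0_iff)
  show ?thesis
    using is_norm_matrix_vector_le[OF N1 N2, of A "(1 / N1 ?v) *\<^sub>R ?v"]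
      is_norm_nonneg[OF N2, of "A *v ((1 / N1 ?v) *\<^sub>R ?v)"] is_norm_normalized[OF N1 v]
    by simp
qed

text \<open>The defining property of the logarithmic norm as an upper bound. The limes superior is taken in the
  extended reals, and its conversion to a real is harmless for this bound as soon as it is not \<open>\<infinity>\<close>,
  which follows from subadditivity of the operator norm.\<close>

lemma op_norm_le_log_norm:
  fixes A :: "real^'n^'n"
  assumes N: "is_norm N" and \<epsilon>: "0 < \<epsilon>"
  shows "\<forall>\<^sub>F h in at_right 0. op_norm N N (mat 1 + h *\<^sub>R A) \<le> 1 + h * (log_norm N A + \<epsilon>)"
proof -
  let ?q = "\<lambda>h. ereal ((op_norm N N (mat 1 + h *\<^sub>R A) - 1) / h)"
  let ?L = "Limsup (at_right 0) ?q"
  have pos: "\<forall>\<^sub>F h :: real in at_right 0. 0 < h" by (simp add: eventually_at_right_less)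
  have q: "?q h \<le> ereal (op_norm N N A)" if "0 < h" for h
  proof -
    have "op_norm N N (mat 1 + h *\<^sub>R A) \<le> 1 + h * op_norm N N A"
    proof (rule op_norm_le[OF N])
      fix x assume x: "N x = 1"
      have "N ((mat 1 + h *\<^sub>R A) *v x) = N (x + h *\<^sub>R (A *v x))"
        by (simp only: matrix_vector_mult_add_rdistrib scaleR_matrix_vector_assoc[symmetric] matrix_vector_mul_lid)
      also have "\<dots> \<le> N x + h * N (A *v x)"
        using is_norm_triangle[OF N, of x "h *\<^sub>R (A *v x)"] that by (simp add: is_norm_scaleR[OF N])
      also have "\<dots> \<le> 1 + h * op_norm N N A"
        using is_norm_matrix_vector_le[OF N N, of A x] x that by simp
      finally show "N ((mat 1 + h *\<^sub>R A) *v x) \<le> 1 + h * op_norm N N A" .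
    qed
    then show ?thesis using that by (simp add: pos_divide_le_eq mult.commute)
  qed
  have "?L \<le> ereal (op_norm N N A)"
    by (rule Limsup_bounded, rule eventually_mono[OF pos q])
  then have "?L \<noteq> \<infinity>" by auto
  then have "?L < ereal (log_norm N A + \<epsilon>)"
    using \<epsilon> unfolding log_norm_def by (cases ?L) auto
  then have "\<forall>\<^sub>F h in at_right 0. ?q h < ereal (log_norm N A + \<epsilon>)" by (rule Limsup_lessD)
  then show ?thesis using pos
    by eventually_elim (simp add: pos_divide_less_eq algebra_simps)
qed

lemma convex_on_hull_le:
  assumes "convex_on UNIV \<phi>" "B \<in> convex hull S" "\<And>M. M \<in> S \<Longrightarrow> \<phi> M \<le> c"
  shows "\<phi> B \<le> c"
  using convex_on_convex_hull_bound[of S \<phi> c] convex_on_subset[OF assms(1)] assms(2,3) by auto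

lemma matrix_inv_mult_left:
  fixes A :: "'a::semiring_1^'n^'m"
  assumes "invertible A"
  shows "matrix_inv A ** A = mat 1"
  using someI_ex[OF assms[unfolded invertible_def]] unfolding matrix_inv_def by blast

lemma linear_scaled_matrix_action:
  fixes \<alpha> :: "real^'n^'k" and v :: "real^'m"
  shows "linear (\<lambda>M :: real^'m^'n. k *\<^sub>R (\<alpha> *v (M *v v)))"
  by (intro linearI) (simp_all add: matrix_vector_mult_add_rdistrib matrix_vector_right_distrib
      scaleR_add_right scaleR_matrix_vector_assoc[symmetric] matrix_vector_mult_scaleR)

section \<open>Regularity of the vector fields\<close>

lemma locally_lipschitz_on_imp_continuous_on:
  assumes "locally_lipschitz_on S g"
  shows "continuous_on S g"
  unfolding continuous_on_eq_continuous_within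
proof
  fix p assume p: "p \<in> S"
  then obtain r L where rL: "r > 0" "L-lipschitz_on (ball p r \<inter> S) g"
    using assms unfolding locally_lipschitz_on_def by blast
  have "continuous_on (ball p r \<inter> S) g" using rL(2) by (rule lipschitz_on_continuous_on)
  then have "continuous (at p within ball p r \<inter> S) g"
    using p rL(1) by (auto simp: continuous_on_eq_continuous_within)
  moreover have "at p within ball p r \<inter> S = at p within S"
    using rL(1) by (intro at_within_nhd[of p "ball p r"]) auto
  ultimately show "continuous (at p within S) g" by simp
qed

text \<open>The two points compared share \<open>t\<close> and \<open>w\<close>, so the mean value inequality runs within a ball of
  states; compactness of the times, states and disturbances bounds the derivative uniformly.\<close>

lemma C1_lipschitz_in_state:
  fixes f :: "real \<times> 'a::euclidean_space \<times> 'b::euclidean_space \<Rightarrow> 'c::euclidean_space"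
  assumes f: "C1_on ({0..} \<times> UNIV \<times> UNIV) f" and W: "compact W"
  obtains L where "0 < L"
    "\<And>t (x :: 'a) x' w. 0 \<le> t \<Longrightarrow> t \<le> T \<Longrightarrow> norm x \<le> R \<Longrightarrow> norm x' \<le> R \<Longrightarrow> w \<in> W \<Longrightarrow>
       norm (f (t, x, w) - f (t, x', w)) \<le> L * norm (x - x')"
proof -
  obtain f' where f': "\<And>z. z \<in> {0..} \<times> UNIV \<times> UNIV \<Longrightarrow>
      (f has_derivative blinfun_apply (f' z)) (at z within {0..} \<times> UNIV \<times> UNIV)"
    and cf': "continuous_on ({0..} \<times> UNIV \<times> UNIV) f'"
    using f unfolding C1_on_def by blast
  let ?S = "{0..T} \<times> cball 0 R \<times> W"
  have "compact (f' ` ?S)"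
    using W by (intro compact_continuous_image continuous_on_subset[OF cf'] compact_Times) auto
  then have "bounded (f' ` ?S)" by (rule compact_imp_bounded)
  then obtain L where L: "0 < L" "\<And>z. z \<in> ?S \<Longrightarrow> norm (f' z) \<le> L"
    unfolding bounded_pos by (metis imageI)
  show thesis
  proof (rule that[OF L(1)])
    fix t and x x' :: 'a and w assume A: "0 \<le> t" "t \<le> T" "norm x \<le> R" "norm x' \<le> R" "w \<in> W"
    show "norm (f (t, x, w) - f (t, x', w)) \<le> L * norm (x - x')"
    proof (rule differentiable_bound[where S = "cball 0 R"])
      fix \<xi> :: 'a assume \<xi>: "\<xi> \<in> cball 0 R"
      show "((\<lambda>\<xi>. f (t, \<xi>, w)) has_derivative (\<lambda>v. f' (t, \<xi>, w) (0, v, 0))) (at \<xi> within cball 0 R)"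
        using A(1) \<xi>
        by (intro has_derivative_in_compose2[OF f']) (auto intro!: derivative_eq_intros)
      show "onorm (\<lambda>v. f' (t, \<xi>, w) (0, v, 0)) \<le> L"
      proof (rule onorm_le)
        fix v
        have "norm (f' (t, \<xi>, w) (0, v, 0)) \<le> norm (f' (t, \<xi>, w)) * norm ((0, v, 0) :: real \<times> 'a \<times> 'b)"
          by (rule norm_blinfun)
        also have "\<dots> \<le> L * norm v"
          using L(2)[of "(t, \<xi>, w)"] A \<xi> by (simp add: norm_Pair mult_right_mono)
        finally show "norm (f' (t, \<xi>, w) (0, v, 0)) \<le> L * norm v" .
      qed
    qed (use A in auto)
  qed
qed

section \<open>Growth of the norm outside a normotope\<close>

text \<open>Points on the level set are moved out of the normotope by any further radial stretching.\<close>

lemma normotope_frontierI: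
  assumes N: "is_norm N" and y: "0 < y" and x: "N (\<alpha> *v (x - c)) = y"
  shows "x \<in> frontier (normotope N c \<alpha> y)"
proof -
  have "x \<in> normotope N c \<alpha> y" using x by (simp add: normotope_def)
  moreover have "x \<notin> interior (normotope N c \<alpha> y)"
  proof
    assume "x \<in> interior (normotope N c \<alpha> y)"
    then obtain r where r: "r > 0" "cball x r \<subseteq> normotope N c \<alpha> y"
      by (auto simp: mem_interior_cball)
    define \<eta> where "\<eta> = r / (norm (x - c) + 1)"
    have \<eta>: "0 < \<eta>" using r by (simp add: \<eta>_def add_nonneg_pos)
    have "\<eta> * norm (x - c) \<le> \<eta> * (norm (x - c) + 1)" using \<eta> by simp
    also have "\<dots> = r" by (simp add: \<eta>_def add_nonneg_eq_0_iff)
    finally have "x + \<eta> *\<^sub>R (x - c) \<in> cball x r" using \<eta> by (simp add: dist_norm)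
    then have "N (\<alpha> *v (x + \<eta> *\<^sub>R (x - c) - c)) \<le> y" using r by (auto simp: normotope_def)
    also have "x + \<eta> *\<^sub>R (x - c) - c = (1 + \<eta>) *\<^sub>R (x - c)" by (simp add: algebra_simps)
    finally have "(1 + \<eta>) * y \<le> y"
      using \<eta> x by (simp add: matrix_vector_mult_scaleR is_norm_scaleR[OF N])
    then show False using mult_pos_pos[OF \<eta> y] by (simp add: distrib_right)
  qed
  ultimately show ?thesis using closure_subset by (auto simp: frontier_def)
qed

text \<open>The pointwise core. Here \<open>xb\<close> is the radial projection of \<open>x\<close> onto the boundary of the normotope,
  \<open>A\<close>, \<open>B\<close> and \<open>u\<close> represent the increment of the vector field at \<open>xb\<close>, and \<open>r\<close> is its change from
  \<open>xb\<close> to \<open>x\<close>. With \<open>e = \<alpha> (x - c)\<close> and \<open>\<theta> = y / N e\<close>, the drift due to \<open>U\<close> and \<open>A\<close> at \<open>xb\<close> is \<open>\<theta>\<close> times the value of the linear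
  field \<open>U \<alpha>\<inverse> + \<alpha> A \<alpha>\<inverse>\<close> at \<open>e\<close>. A step of length \<open>h\<close> is therefore a step of length \<open>h \<theta>\<close> for this field,
  and increases \<open>N\<close> by about \<open>h \<theta> N e = h y\<close> times the logarithmic norm.\<close>

lemma embedding_directional_bound:
  fixes \<alpha> U A :: "real^'n^'n" and B :: "real^'m^'n" and c x xb r :: "real^'n" and u :: "real^'m"
  assumes N: "is_norm N" and Nw: "is_norm Nw" and inv: "invertible \<alpha>"
    and y: "0 < y" "y \<le> N (\<alpha> *v (x - c))"
    and xb: "xb = c + (y / N (\<alpha> *v (x - c))) *\<^sub>R (x - c)"
    and fin: "finite Mx" "finite Mw"
    and A: "A \<in> convex hull Mx" and B: "B \<in> convex hull Mw" and u: "Nw u \<le> 1"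
    and \<epsilon>: "0 < \<epsilon>"
  shows "\<exists>h>0. N (\<alpha> *v (x - c) + h *\<^sub>R (U *v (x - c) + \<alpha> *v (A *v (xb - c) + B *v u + r)))
    \<le> N (\<alpha> *v (x - c)) + h *
      (Max ((\<lambda>M. log_norm N (U ** matrix_inv \<alpha> + \<alpha> ** M ** matrix_inv \<alpha>)) ` Mx) * y
        + Max ((\<lambda>M. op_norm Nw N (\<alpha> ** M)) ` Mw) + N (U *v (x - xb) + \<alpha> *v r) + \<epsilon>)"
proof -
  define e where "e = \<alpha> *v (x - c)"
  define \<theta> where "\<theta> = y / N e"
  have Ne: "0 < N e" using y by (simp add: e_def)
  have \<theta>: "0 < \<theta>" "\<theta> * N e = y" using y Ne by (auto simp: \<theta>_def)
  have xbc: "xb - c = \<theta> *\<^sub>R (x - c)" and xxb: "x - xb = (x - c) - \<theta> *\<^sub>R (x - c)"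
    by (auto simp: xb \<theta>_def e_def)
  define V where "V M = U ** matrix_inv \<alpha> + \<alpha> ** M ** matrix_inv \<alpha>" for M
  have inv_e: "matrix_inv \<alpha> *v e = x - c"
    using matrix_inv_mult_left[OF inv] by (simp add: e_def matrix_vector_mul_assoc)
  have V: "V M *v e = U *v (x - c) + \<alpha> *v (M *v (x - c))" for M
    unfolding V_def matrix_vector_mult_add_rdistrib
    by (simp only: matrix_vector_mul_assoc[symmetric] inv_e)
  define m where "m = Max ((\<lambda>M. log_norm N (V M)) ` Mx)"
  define m' where "m' = Max ((\<lambda>M. op_norm Nw N (\<alpha> ** M)) ` Mw)"
  have m: "log_norm N (V M) \<le> m" if "M \<in> Mx" for M
    unfolding m_def using fin that by (intro Max_ge) auto
  have m': "op_norm Nw N (\<alpha> ** M) \<le> m'" if "M \<in> Mw" for M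
    unfolding m'_def using fin that by (intro Max_ge) auto
  \<comment> \<open>The slack in the logarithmic norm is multiplied by \<open>y\<close> later on.\<close>
  define \<delta> where "\<delta> = \<epsilon> / y"
  have \<delta>: "0 < \<delta>" using \<epsilon> y by (simp add: \<delta>_def)
  have "\<forall>\<^sub>F k in at_right 0. \<forall>M\<in>Mx. op_norm N N (mat 1 + k *\<^sub>R V M) \<le> 1 + k * (log_norm N (V M) + \<delta>)"
    using fin(1) op_norm_le_log_norm[OF N \<delta>] by (intro eventually_ball_finite) auto
  moreover have "\<forall>\<^sub>F k :: real in at_right 0. 0 < k" by (simp add: eventually_at_right_less)
  ultimately have "\<forall>\<^sub>F k in at_right 0. 0 < k \<and>
      (\<forall>M\<in>Mx. op_norm N N (mat 1 + k *\<^sub>R V M) \<le> 1 + k * (log_norm N (V M) + \<delta>))"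
    by eventually_elim simp
  then obtain k where k: "0 < k"
    "\<And>M. M \<in> Mx \<Longrightarrow> op_norm N N (mat 1 + k *\<^sub>R V M) \<le> 1 + k * (log_norm N (V M) + \<delta>)"
    using eventually_happens'[OF trivial_limit_at_right_real[of 0]] by blast
  \<comment> \<open>\<open>k\<close> is the step for the linear field, \<open>h\<close> the corresponding one for the trajectory.\<close>
  define h where "h = k / \<theta>"
  have h: "0 < h" "h * \<theta> = k" using k \<theta> by (auto simp: h_def)
  have drift: "N ((e + k *\<^sub>R (U *v (x - c))) + k *\<^sub>R (\<alpha> *v (A *v (x - c)))) \<le> N e + h * (m * y + \<epsilon>)"
  proof (rule convex_on_hull_le[OF is_norm_affine_convex_on[OF N linear_scaled_matrix_action] A])
    fix M assume M: "M \<in> Mx"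
    have "(e + k *\<^sub>R (U *v (x - c))) + k *\<^sub>R (\<alpha> *v (M *v (x - c))) = e + k *\<^sub>R (V M *v e)"
      by (simp only: V scaleR_add_right add.assoc)
    also have "\<dots> = (mat 1 + k *\<^sub>R V M) *v e"
      by (simp only: matrix_vector_mult_add_rdistrib scaleR_matrix_vector_assoc[symmetric] matrix_vector_mul_lid)
    finally have "N ((e + k *\<^sub>R (U *v (x - c))) + k *\<^sub>R (\<alpha> *v (M *v (x - c))))
        \<le> op_norm N N (mat 1 + k *\<^sub>R V M) * N e"
      using is_norm_matrix_vector_le[OF N N] by simp
    also have "\<dots> \<le> (1 + k * (m + \<delta>)) * N e"
    proof (rule mult_right_mono)
      have "k * (log_norm N (V M) + \<delta>) \<le> k * (m + \<delta>)" using m[OF M] k(1) by simp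
      then show "op_norm N N (mat 1 + k *\<^sub>R V M) \<le> 1 + k * (m + \<delta>)" using k(2)[OF M] by linarith
    qed (use Ne in simp)
    also have "\<dots> = N e + h * (\<theta> * N e) * (m + \<delta>)"
      unfolding h(2)[symmetric] by (simp add: algebra_simps)
    also have "\<dots> = N e + h * (m * y + \<epsilon>)"
      using y unfolding \<theta>(2) by (simp add: \<delta>_def field_simps)
    finally show "N ((e + k *\<^sub>R (U *v (x - c))) + k *\<^sub>R (\<alpha> *v (M *v (x - c)))) \<le> N e + h * (m * y + \<epsilon>)" .
  qed
  have "N (0 + 1 *\<^sub>R (\<alpha> *v (B *v u))) \<le> m'"
  proof (rule convex_on_hull_le[OF is_norm_affine_convex_on[OF N linear_scaled_matrix_action] B])
    fix M assume M: "M \<in> Mw"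
    have "N (0 + 1 *\<^sub>R (\<alpha> *v (M *v u))) = N ((\<alpha> ** M) *v u)"
      by (simp add: matrix_vector_mul_assoc)
    also have "\<dots> \<le> op_norm Nw N (\<alpha> ** M) * Nw u" by (rule is_norm_matrix_vector_le[OF Nw N])
    also have "\<dots> \<le> op_norm Nw N (\<alpha> ** M)" using op_norm_nonneg[OF Nw N] u by (rule mult_left_le[rotated])
    also have "\<dots> \<le> m'" using m'[OF M] .
    finally show "N (0 + 1 *\<^sub>R (\<alpha> *v (M *v u))) \<le> m'" .
  qed
  then have dist: "N (\<alpha> *v (B *v u)) \<le> m'" by simp
  let ?q = "U *v (x - xb) + \<alpha> *v r"
  have "e + h *\<^sub>R (U *v (x - c) + \<alpha> *v (A *v (xb - c) + B *v u + r))
      = ((e + k *\<^sub>R (U *v (x - c))) + k *\<^sub>R (\<alpha> *v (A *v (x - c)))) + h *\<^sub>R (\<alpha> *v (B *v u) + ?q)"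
    unfolding xbc xxb h(2)[symmetric] matrix_vector_mult_diff_distrib matrix_vector_right_distrib
      matrix_vector_mult_scaleR
    by (simp add: scaleR_add_right scaleR_diff_right)
  then have "N (e + h *\<^sub>R (U *v (x - c) + \<alpha> *v (A *v (xb - c) + B *v u + r)))
      \<le> N ((e + k *\<^sub>R (U *v (x - c))) + k *\<^sub>R (\<alpha> *v (A *v (x - c)))) + N (h *\<^sub>R (\<alpha> *v (B *v u) + ?q))"
    using is_norm_triangle[OF N] by metis
  also have "N (h *\<^sub>R (\<alpha> *v (B *v u) + ?q)) = h * N (\<alpha> *v (B *v u) + ?q)"
    using h(1) by (simp add: is_norm_scaleR[OF N])
  also have "N (\<alpha> *v (B *v u) + ?q) \<le> m' + N ?q"
    using is_norm_triangle[OF N, of "\<alpha> *v (B *v u)" ?q] dist by linarith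
  finally have "N (e + h *\<^sub>R (U *v (x - c) + \<alpha> *v (A *v (xb - c) + B *v u + r)))
      \<le> N e + h * (m * y + \<epsilon>) + h * (m' + N ?q)"
    using drift h(1) by (simp add: mult_left_mono)
  also have "\<dots> = N e + h * (m * y + m' + N ?q + \<epsilon>)" by (simp add: distrib_left)
  finally show ?thesis using h(1) unfolding e_def m_def m'_def V_def by blast
qed

section \<open>Invariance of the moving normotope\<close>

text \<open>Were \<open>g b\<close> positive, then after its last zero \<open>c\<close> the function would be positive. On an interval
  from \<open>c\<close> of length at most \<open>1 / (2 L)\<close> its maximum would be at most half of itself.\<close>

lemma nonpos_of_integral_gronwall:
  fixes g :: "real \<Rightarrow> real"
  assumes cg: "continuous_on {a..b} g" and ab: "a \<le> b" and ga: "g a \<le> 0" and L: "0 < L"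
    and growth: "\<And>s t. a \<le> s \<Longrightarrow> s \<le> t \<Longrightarrow> t \<le> b \<Longrightarrow> (\<And>r. s \<le> r \<Longrightarrow> r \<le> t \<Longrightarrow> 0 \<le> g r) \<Longrightarrow>
       g t - g s \<le> L * integral {s..t} g"
  shows "g b \<le> 0"
proof (rule ccontr)
  assume "\<not> g b \<le> 0"
  then have gb: "0 < g b" by simp
  define S where "S = {s \<in> {a..b}. g s \<le> 0}"
  have "closed S" unfolding S_def
    by (intro continuous_on_closed_Collect_le cg continuous_on_const closed_real_atLeastAtMost)
  moreover have "bounded S" by (rule bounded_subset[of "{a..b}"]) (auto simp: S_def)
  ultimately have "compact S" by (simp add: compact_eq_bounded_closed)
  moreover have "S \<noteq> {}" using ga ab by (auto simp: S_def)
  ultimately obtain c where c: "c \<in> S" "\<And>s. s \<in> S \<Longrightarrow> s \<le> c" by (metis compact_attains_sup)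
  have cab: "a \<le> c" "c < b" "g c \<le> 0" using c(1) gb by (auto simp: S_def order.order_iff_strict)
  have after: "0 < g s" if "c < s" "s \<le> b" for s
    using c(2)[of s] that cab by (force simp: S_def)
  have "\<exists>s\<ge>c. s \<le> b \<and> g s = 0"
    using cab gb by (intro IVT' continuous_on_subset[OF cg]) auto
  then have gc: "g c = 0" using c after by force
  define d where "d = min b (c + 1 / (2 * L))"
  have d: "c < d" "d \<le> b" "d - c \<le> 1 / (2 * L)" using cab L by (auto simp: d_def)
  obtain s where s: "s \<in> {c..d}" "\<And>r. r \<in> {c..d} \<Longrightarrow> g r \<le> g s"
    using continuous_attains_sup[of "{c..d}" g] continuous_on_subset[OF cg] d cab by force
  have gs: "0 < g s" using s(2)[of d] after[of d] d by auto
  have nonneg: "0 \<le> g r" if "c \<le> r" "r \<le> s" for r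
    using after[of r] gc that s d by (cases "r = c") auto
  have "g s - g c \<le> L * integral {c..s} g"
    using growth[of c s] nonneg cab s d by auto
  also have "integral {c..s} g \<le> integral {c..s} (\<lambda>_. g s)"
    using s d cab by (intro integral_le integrable_continuous_real continuous_on_subset[OF cg]) auto
  also have "\<dots> = (s - c) * g s" using s by simp
  also have "\<dots> \<le> 1 / (2 * L) * g s" using s d gs by (intro mult_right_mono) auto
  finally have "g s \<le> L * (1 / (2 * L) * g s)" using gc L by simp
  also have "\<dots> = g s / 2" using L by simp
  finally show False using gs by simp
qed

text \<open>The constant \<open>L\<close> of the differential inequality \<open>g' \<le> L g\<close> comes from compactness of the time interval: it
  bounds \<open>U\<close>, \<open>\<alpha>\<close> and the states along the trajectories, and keeps \<open>y\<close> away from \<open>0\<close>.\<close>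

lemma trajectory_in_normotope:
  fixes f :: "real \<times> (real^'n) \<times> (real^'m) \<Rightarrow> real^'n"
    and U :: "real \<times> (real^'n) \<times> (real^'n^'n) \<times> real \<Rightarrow> real^'n^'n"
    and x xc :: "real \<Rightarrow> real^'n"
  assumes f_C1: "C1_on ({0..} \<times> UNIV \<times> UNIV) f"
    and N: "is_norm N" and Nw: "is_norm Nw"
    and W: "compact W"
    and W_unit: "\<And>w. w \<in> W \<Longrightarrow> Nw (w - wc) \<le> 1"
    and U_cont: "continuous_on embedding_domain U"
    and T: "0 \<le> T"
    and M_finite: "\<And>t. 0 \<le> t \<Longrightarrow> t \<le> T \<Longrightarrow> finite (Mx t) \<and> finite (Mw t)"
    and M_incl: "\<And>t x w. 0 \<le> t \<Longrightarrow> t \<le> T \<Longrightarrow> x \<in> frontier (normotope N (xc t) (\<alpha> t) (y t)) \<Longrightarrow> w \<in> W \<Longrightarrow>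
        f (t, x, w) - f (t, xc t, wc) \<in>
          {A *v (x - xc t) + B *v (w - wc) |A B. A \<in> convex hull (Mx t) \<and> B \<in> convex hull (Mw t)}"
    and dom: "\<And>t. 0 \<le> t \<Longrightarrow> t \<le> T \<Longrightarrow> (t, xc t, \<alpha> t, y t) \<in> embedding_domain"
    and emb: "primitive_on 0 T (\<lambda>s. embedding_field N Nw f U Mx Mw wc s (xc s, \<alpha> s, y s)) (\<lambda>t. (xc t, \<alpha> t, y t))"
    and x: "primitive_on 0 T (\<lambda>s. f (s, x s, w s)) x"
    and w: "\<And>s. 0 \<le> s \<Longrightarrow> s \<le> T \<Longrightarrow> w s \<in> W"
    and x_init: "x 0 \<in> normotope N (xc 0) (\<alpha> 0) (y 0)"
  shows "x T \<in> normotope N (xc T) (\<alpha> T) (y T)"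
proof -
  define V where "V s = U (s, xc s, \<alpha> s, y s)" for s
  define Y where "Y s = Max ((\<lambda>M. log_norm N (V s ** matrix_inv (\<alpha> s) + \<alpha> s ** M ** matrix_inv (\<alpha> s))) ` Mx s) * y s
      + Max ((\<lambda>M. op_norm Nw N (\<alpha> s ** M)) ` Mw s)" for s
  have emb': "primitive_on 0 T (\<lambda>s. (f (s, xc s, wc), V s, Y s)) (\<lambda>t. (xc t, \<alpha> t, y t))"
    using emb by (simp add: embedding_field_def V_def Y_def)
  have xc: "primitive_on 0 T (\<lambda>s. f (s, xc s, wc)) xc"
    using primitive_on_bounded_linear[OF emb' bounded_linear_fst] by simp
  have \<alpha>: "primitive_on 0 T V \<alpha>"
    using primitive_on_bounded_linear[OF emb' bounded_linear_compose[OF bounded_linear_fst bounded_linear_snd]] by simp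
  have y: "primitive_on 0 T Y y"
    using primitive_on_bounded_linear[OF emb' bounded_linear_compose[OF bounded_linear_snd bounded_linear_snd]] by simp
  define e where "e s = \<alpha> s *v (x s - xc s)" for s
  define E where "E s = V s *v (x s - xc s) + \<alpha> s *v (f (s, x s, w s) - f (s, xc s, wc))" for s
  have e: "primitive_on 0 T E e"
    using primitive_on_bilinear[OF bounded_bilinear_matrix_vector_mult \<alpha> primitive_on_diff[OF x xc]]
    unfolding E_def[abs_def] e_def[abs_def] .
  note cont = primitive_on_continuous[OF xc] primitive_on_continuous[OF \<alpha>]
    primitive_on_continuous[OF y] primitive_on_continuous[OF x] primitive_on_continuous[OF e]
  have dom': "invertible (\<alpha> s) \<and> 0 < y s" if "0 \<le> s" "s \<le> T" for s
    using dom[OF that] by (simp add: embedding_domain_def)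
  have cV: "continuous_on {0..T} V"
    unfolding V_def[abs_def]
    by (rule continuous_on_compose2[OF U_cont]) (use dom in \<open>auto intro!: continuous_intros cont\<close>)
  obtain K where K: "0 < K" "\<And>(A :: real^'n^'n) (v :: real^'n). norm (A *v v) \<le> norm A * norm v * K"
    using bounded_bilinear.pos_bounded[OF bounded_bilinear_matrix_vector_mult] by blast
  obtain C where C: "0 < C" "\<And>v. N v \<le> C * norm v" using is_norm_le_norm[OF N] by blast
  obtain lipN where lipN: "lipN-lipschitz_on UNIV N" using is_norm_lipschitz[OF N] .
  obtain BV where BV: "0 < BV" "\<And>s. s \<in> {0..T} \<Longrightarrow> norm (V s) \<le> BV"
    using continuous_on_interval_bounded[OF cV] by blast
  obtain Ba where Ba: "0 < Ba" "\<And>s. s \<in> {0..T} \<Longrightarrow> norm (\<alpha> s) \<le> Ba"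
    using continuous_on_interval_bounded[OF cont(2)] by blast
  obtain Bx where Bx: "0 < Bx" "\<And>s. s \<in> {0..T} \<Longrightarrow> norm (x s) \<le> Bx"
    using continuous_on_interval_bounded[OF cont(4)] by blast
  obtain Bc where Bc: "0 < Bc" "\<And>s. s \<in> {0..T} \<Longrightarrow> norm (xc s) \<le> Bc"
    using continuous_on_interval_bounded[OF cont(1)] by blast
  \<comment> \<open>Bounds the states and also the distance between the two trajectories.\<close>
  define R where "R = Bx + Bc"
  have R: "0 < R" using Bx Bc by (simp add: R_def)
  obtain Lf where Lf: "0 < Lf"
    "\<And>t (x :: real^'n) x' w. 0 \<le> t \<Longrightarrow> t \<le> T \<Longrightarrow> norm x \<le> R \<Longrightarrow> norm x' \<le> R \<Longrightarrow> w \<in> W \<Longrightarrow>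
       norm (f (t, x, w) - f (t, x', w)) \<le> Lf * norm (x - x')"
    using C1_lipschitz_in_state[OF f_C1 W] by metis
  obtain s0 where s0: "s0 \<in> {0..T}" "\<And>s. s \<in> {0..T} \<Longrightarrow> y s0 \<le> y s"
    using continuous_attains_inf[OF compact_Icc _ cont(3)] T by auto
  have y0: "0 < y s0" using dom'[of s0] s0(1) by auto
  define Q where "Q = C * K * (BV + Ba * Lf)"
  have Q: "0 < Q" using C K BV Ba Lf by (simp add: Q_def add_pos_pos)
  define L where "L = Q * (R / y s0)"
  have L: "0 < L" using Q R y0 by (simp add: L_def)
  define g where "g s = N (e s) - y s" for s
  have cg: "continuous_on {0..T} g"
    unfolding g_def[abs_def]
    by (intro continuous_intros cont continuous_on_compose2[OF lipschitz_on_continuous_on[OF lipN]]) auto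
  have step: "\<exists>h>0. N (e s + h *\<^sub>R E s) \<le> N (e s) + h * (Y s + L * g s + \<epsilon>)"
    if s: "0 \<le> s" "s \<le> T" and gs: "0 \<le> g s" and \<epsilon>: "0 < \<epsilon>" for s \<epsilon>
  proof -
    define \<theta> where "\<theta> = y s / N (e s)"
    define xb where "xb = xc s + \<theta> *\<^sub>R (x s - xc s)"
    have ys: "0 < y s" "invertible (\<alpha> s)" "y s \<le> N (e s)" "y s0 \<le> y s"
      using dom'[OF s] gs s0(2)[of s] s by (auto simp: g_def)
    have \<theta>: "0 \<le> \<theta>" "\<theta> \<le> 1" using ys by (auto simp: \<theta>_def)
    have "\<alpha> s *v (xb - xc s) = \<theta> *\<^sub>R e s" by (simp add: xb_def e_def matrix_vector_mult_scaleR)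
    then have "N (\<alpha> s *v (xb - xc s)) = y s"
      using \<theta> ys by (simp add: is_norm_scaleR[OF N]) (simp add: \<theta>_def)
    then have "xb \<in> frontier (normotope N (xc s) (\<alpha> s) (y s))"
      using normotope_frontierI[OF N ys(1)] by blast
    from M_incl[OF s this w[OF s]] obtain A B where AB: "A \<in> convex hull (Mx s)" "B \<in> convex hull (Mw s)"
      "f (s, xb, w s) - f (s, xc s, wc) = A *v (xb - xc s) + B *v (w s - wc)" by blast
    define r where "r = f (s, x s, w s) - f (s, xb, w s)"
    have "f (s, x s, w s) - f (s, xc s, wc) = A *v (xb - xc s) + B *v (w s - wc) + r"
      unfolding AB(3)[symmetric] r_def by simp
    then have Es: "E s = V s *v (x s - xc s) + \<alpha> s *v (A *v (xb - xc s) + B *v (w s - wc) + r)"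
      by (simp add: E_def)
    have xxb: "x s - xb = (1 - \<theta>) *\<^sub>R (x s - xc s)" by (simp add: xb_def algebra_simps)
    have nx: "norm (x s) \<le> R" "norm (x s - xc s) \<le> R"
      using Bx Bc s norm_triangle_ineq4[of "x s" "xc s"] by (fastforce simp: R_def)+
    have "xb = \<theta> *\<^sub>R x s + (1 - \<theta>) *\<^sub>R xc s" by (simp add: xb_def algebra_simps)
    then have "norm xb \<le> \<theta> * norm (x s) + (1 - \<theta>) * norm (xc s)"
      using norm_triangle_ineq[of "\<theta> *\<^sub>R x s" "(1 - \<theta>) *\<^sub>R xc s"] \<theta> by simp
    also have "\<dots> \<le> 1 * Bx + 1 * Bc" using \<theta> Bx Bc s by (intro add_mono mult_mono) auto
    finally have nxb: "norm xb \<le> R" by (simp add: R_def)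
    have nr: "norm r \<le> Lf * norm (x s - xb)" unfolding r_def using Lf(2)[OF s nx(1) nxb w[OF s]] .
    have "N (V s *v (x s - xb) + \<alpha> s *v r) \<le> C * norm (V s *v (x s - xb) + \<alpha> s *v r)" by (rule C(2))
    also have "\<dots> \<le> C * (norm (V s *v (x s - xb)) + norm (\<alpha> s *v r))"
      using C(1) norm_triangle_ineq by (intro mult_left_mono) auto
    also have "\<dots> \<le> C * (BV * norm (x s - xb) * K + Ba * (Lf * norm (x s - xb)) * K)"
    proof (intro mult_left_mono add_mono)
      show "norm (V s *v (x s - xb)) \<le> BV * norm (x s - xb) * K"
        using K BV s by (intro order.trans[OF K(2)] mult_right_mono) auto
      show "norm (\<alpha> s *v r) \<le> Ba * (Lf * norm (x s - xb)) * K"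
        using K Ba s nr by (intro order.trans[OF K(2)] mult_right_mono mult_mono) auto
    qed (use C in simp)
    also have "\<dots> = Q * norm (x s - xb)" by (simp add: Q_def algebra_simps)
    also have "norm (x s - xb) = (1 - \<theta>) * norm (x s - xc s)" using \<theta> by (simp add: xxb)
    also have "Q * ((1 - \<theta>) * norm (x s - xc s)) \<le> Q * ((g s / y s0) * R)"
    proof (intro mult_left_mono mult_mono)
      \<comment> \<open>Relative to the distance from the center, the projection moves by a multiple of \<open>g\<close>.\<close>
      have "1 - \<theta> = g s / N (e s)" using ys by (simp add: \<theta>_def g_def field_simps)
      also have "\<dots> \<le> g s / y s0" using gs ys y0 by (intro divide_left_mono) auto
      finally show "1 - \<theta> \<le> g s / y s0" .
    qed (use nx \<theta> gs y0 Q in auto)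
    also have "\<dots> = L * g s" by (simp add: L_def)
    finally have rem: "N (V s *v (x s - xb) + \<alpha> s *v r) \<le> L * g s" .
    obtain h where h: "0 < h" "N (e s + h *\<^sub>R E s) \<le> N (e s) + h * (Y s + N (V s *v (x s - xb) + \<alpha> s *v r) + \<epsilon>)"
      using embedding_directional_bound[OF N Nw ys(2,1) ys(3)[unfolded e_def] xb_def[unfolded \<theta>_def e_def]
          conjunct1[OF M_finite[OF s]] conjunct2[OF M_finite[OF s]] AB(1,2) W_unit[OF w[OF s]] \<epsilon>, of "V s" r]
      unfolding Es Y_def e_def by blast
    have "h * (Y s + N (V s *v (x s - xb) + \<alpha> s *v r) + \<epsilon>) \<le> h * (Y s + L * g s + \<epsilon>)"
      using h(1) rem by (intro mult_left_mono) auto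
    then have "N (e s + h *\<^sub>R E s) \<le> N (e s) + h * (Y s + L * g s + \<epsilon>)" using h(2) by linarith
    then show ?thesis using h(1) by blast
  qed
  have "g T \<le> 0"
  proof (rule nonpos_of_integral_gronwall[OF cg T _ L])
    show "g 0 \<le> 0" using x_init by (simp add: g_def e_def normotope_def)
    fix s t assume st: "0 \<le> s" "s \<le> t" "t \<le> T" and nonneg: "\<And>r. s \<le> r \<Longrightarrow> r \<le> t \<Longrightarrow> 0 \<le> g r"
    have "g integrable_on {s..t}"
      using st by (intro integrable_continuous_real continuous_on_subset[OF cg]) auto
    then have "((\<lambda>r. Y r + L * g r) has_integral (y t - y s) + L * integral {s..t} g) {s..t}"
      using primitive_onD[OF y st] by (intro has_integral_add has_integral_mult_right) (auto simp: integrable_integral)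
    then have "N (e t) - N (e s) \<le> (y t - y s) + L * integral {s..t} g"
      using st nonneg step primitive_on_subinterval[OF e st(1,3)]
      by (intro integral_comparison_convex[OF _ st(2) is_norm_convex_on[OF N] lipN]) auto
    then show "g t - g s \<le> L * integral {s..t} g" by (simp add: g_def)
  qed
  then show ?thesis by (simp add: g_def e_def normotope_def)
qed

theorem theorem1:
  fixes f :: "real \<times> (real^'n) \<times> (real^'m) \<Rightarrow> real^'n"
    and N :: "real^'n \<Rightarrow> real" and Nw :: "real^'m \<Rightarrow> real"
    and W :: "(real^'m) set" and wc :: "real^'m"
    and x0 :: "real^'n" and \<alpha>0 :: "real^'n^'n" and y0 :: real
    and U :: "real \<times> (real^'n) \<times> (real^'n^'n) \<times> real \<Rightarrow> real^'n^'n"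
    and Mx :: "real \<Rightarrow> (real^'n^'n) set" and Mw :: "real \<Rightarrow> (real^'m^'n) set"
    and J :: "real set"
    and xc :: "real \<Rightarrow> real^'n" and \<alpha> :: "real \<Rightarrow> real^'n^'n" and y :: "real \<Rightarrow> real"
  assumes f_C1: "C1_on ({0..} \<times> UNIV \<times> UNIV) f"
    and N_norm: "differentiable_norm N \<or> N = l1_norm \<or> N = infnorm"
    and Nw_norm: "is_norm Nw"
    and W: "compact W" "wc \<in> W"
    and W_unit: "\<And>w. w \<in> W \<Longrightarrow> Nw (w - wc) \<le> 1"
    and init: "invertible \<alpha>0" "0 < y0"
    and U_lip: "locally_lipschitz_on embedding_domain U"
    and J: "is_interval J" "0 \<in> J" "J \<subseteq> {0..}"
    and M_finite: "\<And>t. t \<in> J \<Longrightarrow> finite (Mx t) \<and> finite (Mw t)"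
    and M_incl: "\<And>t x w. t \<in> J \<Longrightarrow> x \<in> frontier (normotope N (xc t) (\<alpha> t) (y t)) \<Longrightarrow> w \<in> W \<Longrightarrow>
        f (t, x, w) - f (t, xc t, wc) \<in>
          {A *v (x - xc t) + B *v (w - wc) |A B. A \<in> convex hull (Mx t) \<and> B \<in> convex hull (Mw t)}"
    and traj_init: "(xc 0, \<alpha> 0, y 0) = (x0, \<alpha>0, y0)"
    and traj_dom: "\<And>t. t \<in> J \<Longrightarrow> (t, xc t, \<alpha> t, y t) \<in> embedding_domain"
    and traj: "ode_solution (embedding_field N Nw f U Mx Mw wc) 0 J (\<lambda>t. (xc t, \<alpha> t, y t))"
  shows "\<forall>t\<in>J. reachable_set f t 0 (normotope N x0 \<alpha>0 y0) W \<subseteq> normotope N (xc t) (\<alpha> t) (y t)"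
proof (intro ballI subsetI)
  fix t p assume t: "t \<in> J" and "p \<in> reachable_set f t 0 (normotope N x0 \<alpha>0 y0) W"
  then obtain x w where p: "p = x t" and x0: "x 0 \<in> normotope N x0 \<alpha>0 y0"
    and w: "\<And>s. s \<in> {0..t} \<Longrightarrow> w s \<in> W"
    and x: "ode_solution (\<lambda>s \<xi>. f (s, \<xi>, w s)) 0 {0..t} x"
    unfolding reachable_set_def by blast
  have t0: "0 \<le> t" using t J by auto
  have inJ: "s \<in> J" if "0 \<le> s" "s \<le> t" for s
    using mem_is_interval_1_I[OF J(1) J(2) t that] .
  have N: "is_norm N"
    using N_norm is_norm_l1 is_norm_infnorm unfolding differentiable_norm_def by blast
  have "x t \<in> normotope N (xc t) (\<alpha> t) (y t)"
  proof (rule trajectory_in_normotope[OF f_C1 N Nw_norm W(1) W_unit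
        locally_lipschitz_on_imp_continuous_on[OF U_lip] t0])
    show "primitive_on 0 t (\<lambda>s. embedding_field N Nw f U Mx Mw wc s (xc s, \<alpha> s, y s)) (\<lambda>t. (xc t, \<alpha> t, y t))"
      using ode_solution_imp_primitive_on[OF traj J(1,2) t] .
    show "primitive_on 0 t (\<lambda>s. f (s, x s, w s)) x"
      using ode_solution_imp_primitive_on[OF x is_interval_cc] t0 by simp
    show "x 0 \<in> normotope N (xc 0) (\<alpha> 0) (y 0)" using x0 traj_init by simp
  qed (use inJ M_finite M_incl traj_dom w in auto)
  then show "p \<in> normotope N (xc t) (\<alpha> t) (y t)" by (simp add: p)
qed

end
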